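(* Let $\mathcal{T}$ be a ($\mathbb{k}$-linear) triangulated category and $\mathcal{S}$ a strictly full triangulated subcategory of $\mathcal{T}$, with inclusion functor $i\colon\mathcal{S}\to\mathcal{T}$ and Verdier quotient functor $q\colon\mathcal{T}\to\mathcal{T}/\mathcal{S}$. Assume that the numerical Grothendieck groups of $\mathcal{T}$, $\mathcal{S}$ and $\mathcal{T}/\mathcal{S}$ all exist. Suppose moreover that $q$ or, equivalently, $i$ preserves compactness, i.e. that there are right adjoints $q_*\colon \mathcal{T}/\mathcal{S}\to\mathcal{T}$ of $q$ and $i_*\colon\mathcal{T}\to\mathcal{S}$ of $i$. Then there is an exact sequence $$K_0^{\mathrm{num}}(\mathcal{S})\to K_0^{\mathrm{num}}(\mathcal{T})\to K_0^{\mathrm{num}}(\mathcal{T}/\mathcal{S})\to 0$$ of numerical Grothendieck groups, whose maps are induced by $i$ and $q$.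
   Context: $\mathbb{k}$ is a field. For a $\mathbb{k}$-linear triangulated category $\mathcal{T}$, $K_0(\mathcal{T})$ is its Grothendieck group. When $\bigoplus_n\operatorname{Hom}_{\mathcal{T}}(a,b[n])$ is finite-dimensional for all $a,b$, the Euler form on $K_0(\mathcal{T})$ is $\chi_{\mathcal{T}}([a],[b])=\sum_{n\in\mathbb{Z}}(-1)^n\dim_{\mathbb{k}}\operatorname{Hom}_{\mathcal{T}}(a,b[n])$. The numerical Grothendieck group of $\mathcal{T}$ exists if the Euler form is well defined and its left and right kernels (radicals) agree; it is then $K_0^{\mathrm{num}}(\mathcal{T})=K_0(\mathcal{T})/\ker(\chi_{\mathcal{T}})$. "Preserves compactness": the motivating case is $\mathcal{T}=D_c(\mathcal{V})$, $\mathcal{S}=D_c(\mathcal{I})$, the compact objects in the derived categories of a DG category $\mathcal{V}$ and a full DG subcategory $\mathcal{I}$; there the condition on $q$ (resp. $i$) says that the right adjoint $q_*$ of $q$ (resp. $i_*$ of $i$) on the big derived categories sends compact objects to compact objects, so that it restricts to a right adjoint between the categories of compact objects. The conditions for $q$ and for $i$ are equivalent in that setting. For general triangulated categories, the condition is understood as the existence of the corresponding right adjoints $q_*$ and $i_*$. *)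

theory Defs
  imports "HOL-Algebra.Algebra" "Jordan_Normal_Form.Missing_VectorSpace"
begin

section \<open>Linear triangulated categories\<close>

text \<open>
  Categories are small: objects and arrows form sets, and every arrow determines its source and
  target, so different hom sets are disjoint.  \<open>g \<star> f\<close> is ``\<open>g\<close> after \<open>f\<close>''.
  The translation functors \<open>[n]\<close>, for all integers \<open>n\<close>, are part of the data
  (\<open>sho\<close> on objects, \<open>sha\<close> on arrows).  A triangle
  \<open>a \<rightarrow> b \<rightarrow> c \<rightarrow> a[1]\<close> is the triple of its arrows.
\<close>

record ('o, 'm, 'k) tricat =
  Ob :: "'o set"
  Arr :: "'m set"
  Dom :: "'m \<Rightarrow> 'o"
  Cod :: "'m \<Rightarrow> 'o"
  idn :: "'o \<Rightarrow> 'm"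
  cmp :: "'m \<Rightarrow> 'm \<Rightarrow> 'm" (infixl \<open>\<star>\<index>\<close> 75)
  azero :: "'o \<Rightarrow> 'o \<Rightarrow> 'm"
  aadd :: "'m \<Rightarrow> 'm \<Rightarrow> 'm"
  ascale :: "'k \<Rightarrow> 'm \<Rightarrow> 'm"
  sho :: "int \<Rightarrow> 'o \<Rightarrow> 'o"
  sha :: "int \<Rightarrow> 'm \<Rightarrow> 'm"
  Dist :: "('m \<times> 'm \<times> 'm) set"

definition mor :: "('o, 'm, 'k) tricat \<Rightarrow> 'o \<Rightarrow> 'o \<Rightarrow> 'm set" where
  "mor C a b = {f \<in> Arr C. Dom C f = a \<and> Cod C f = b}"

text \<open>The ring multiplication and unit in a HOL-Algebra module record play no role.\<close>

definition mor_space :: "('o, 'm, 'k) tricat \<Rightarrow> 'o \<Rightarrow> 'o \<Rightarrow> ('k, 'm) module" where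
  "mor_space C a b =
     \<lparr>carrier = mor C a b, monoid.mult = (\<lambda>f g. azero C a b), one = azero C a b,
      ring.zero = azero C a b, ring.add = aadd C, smult = ascale C\<rparr>"

definition is_iso :: "('o, 'm, 'k) tricat \<Rightarrow> 'm \<Rightarrow> bool" where
  "is_iso C u \<longleftrightarrow> u \<in> Arr C \<and>
     (\<exists>v \<in> mor C (Cod C u) (Dom C u).
        v \<star>\<^bsub>C\<^esub> u = idn C (Dom C u) \<and> u \<star>\<^bsub>C\<^esub> v = idn C (Cod C u))"

definition zero_object :: "('o, 'm, 'k) tricat \<Rightarrow> 'o \<Rightarrow> bool" where
  "zero_object C z \<longleftrightarrow> z \<in> Ob C \<and> idn C z = azero C z z"

record ('o1, 'm1, 'o2, 'm2) functor_data =
  fob :: "'o1 \<Rightarrow> 'o2"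
  farr :: "'m1 \<Rightarrow> 'm2"

definition is_functor ::
    "('o1, 'm1, 'k1) tricat \<Rightarrow> ('o2, 'm2, 'k2) tricat \<Rightarrow> ('o1, 'm1, 'o2, 'm2) functor_data \<Rightarrow> bool" where
  "is_functor C D F \<longleftrightarrow>
     (\<forall>a \<in> Ob C. fob F a \<in> Ob D \<and> farr F (idn C a) = idn D (fob F a)) \<and>
     (\<forall>a \<in> Ob C. \<forall>b \<in> Ob C. \<forall>f \<in> mor C a b. farr F f \<in> mor D (fob F a) (fob F b)) \<and>
     (\<forall>f \<in> Arr C. \<forall>g \<in> Arr C. Dom C g = Cod C f \<longrightarrow>
        farr F (g \<star>\<^bsub>C\<^esub> f) = farr F g \<star>\<^bsub>D\<^esub> farr F f)"

fun triangle :: "('o, 'm, 'k) tricat \<Rightarrow> 'm \<times> 'm \<times> 'm \<Rightarrow> bool" where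
  "triangle C (f, g, h) \<longleftrightarrow>
     f \<in> Arr C \<and> g \<in> Arr C \<and> h \<in> Arr C \<and>
     Dom C g = Cod C f \<and> Dom C h = Cod C g \<and> Cod C h = sho C 1 (Dom C f)"

fun triangle_map ::
    "('o, 'm, 'k) tricat \<Rightarrow> 'm \<times> 'm \<times> 'm \<Rightarrow> 'm \<times> 'm \<times> 'm \<Rightarrow> 'm \<times> 'm \<times> 'm \<Rightarrow> bool" where
  "triangle_map C (f, g, h) (f', g', h') (u, v, w) \<longleftrightarrow>
     u \<in> mor C (Dom C f) (Dom C f') \<and>
     v \<in> mor C (Cod C f) (Cod C f') \<and>
     w \<in> mor C (Cod C g) (Cod C g') \<and>
     v \<star>\<^bsub>C\<^esub> f = f' \<star>\<^bsub>C\<^esub> u \<and>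
     w \<star>\<^bsub>C\<^esub> g = g' \<star>\<^bsub>C\<^esub> v \<and>
     sha C 1 u \<star>\<^bsub>C\<^esub> h = h' \<star>\<^bsub>C\<^esub> w"

definition triangle_iso ::
    "('o, 'm, 'k) tricat \<Rightarrow> 'm \<times> 'm \<times> 'm \<Rightarrow> 'm \<times> 'm \<times> 'm \<Rightarrow> bool" where
  "triangle_iso C t t' \<longleftrightarrow> triangle C t \<and> triangle C t' \<and>
     (\<exists>u v w. triangle_map C t t' (u, v, w) \<and> is_iso C u \<and> is_iso C v \<and> is_iso C w)"

locale klinear_category =
  fixes K :: "('k, 'r) ring_scheme" and C :: "('o, 'm, 'k) tricat" (structure)
  assumes ground_field: "field K"
    and arr_ends: "f \<in> Arr C \<Longrightarrow> Dom C f \<in> Ob C \<and> Cod C f \<in> Ob C"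
    and idn_mor: "a \<in> Ob C \<Longrightarrow> idn C a \<in> mor C a a"
    and cmp_mor: "\<lbrakk>f \<in> mor C a b; g \<in> mor C b c\<rbrakk> \<Longrightarrow> g \<star> f \<in> mor C a c"
    and cmp_assoc: "\<lbrakk>f \<in> mor C a b; g \<in> mor C b c; h \<in> mor C c d\<rbrakk> \<Longrightarrow> (h \<star> g) \<star> f = h \<star> (g \<star> f)"
    and cmp_idn_right: "f \<in> mor C a b \<Longrightarrow> f \<star> idn C a = f"
    and cmp_idn_left: "f \<in> mor C a b \<Longrightarrow> idn C b \<star> f = f"
    and mor_vectorspace: "\<lbrakk>a \<in> Ob C; b \<in> Ob C\<rbrakk> \<Longrightarrow> vectorspace K (mor_space C a b)"
    and cmp_add_right: "\<lbrakk>f \<in> mor C a b; f' \<in> mor C a b; g \<in> mor C b c\<rbrakk> \<Longrightarrow>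
          g \<star> aadd C f f' = aadd C (g \<star> f) (g \<star> f')"
    and cmp_add_left: "\<lbrakk>f \<in> mor C a b; g \<in> mor C b c; g' \<in> mor C b c\<rbrakk> \<Longrightarrow>
          aadd C g g' \<star> f = aadd C (g \<star> f) (g' \<star> f)"
    and cmp_scale_right: "\<lbrakk>k \<in> carrier K; f \<in> mor C a b; g \<in> mor C b c\<rbrakk> \<Longrightarrow>
          g \<star> ascale C k f = ascale C k (g \<star> f)"
    and cmp_scale_left: "\<lbrakk>k \<in> carrier K; f \<in> mor C a b; g \<in> mor C b c\<rbrakk> \<Longrightarrow>
          ascale C k g \<star> f = ascale C k (g \<star> f)"

locale klinear_additive_category = klinear_category +
  assumes zero_object_exists: "\<exists>z. zero_object C z"
    and biproduct_exists: "\<lbrakk>a \<in> Ob C; b \<in> Ob C\<rbrakk> \<Longrightarrow>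
          \<exists>c \<in> Ob C. \<exists>i \<in> mor C a c. \<exists>j \<in> mor C b c. \<exists>p \<in> mor C c a. \<exists>r \<in> mor C c b.
            p \<star> i = idn C a \<and> r \<star> j = idn C b \<and>
            p \<star> j = azero C b a \<and> r \<star> i = azero C a b \<and>
            aadd C (i \<star> p) (j \<star> r) = idn C c"

locale klinear_triangulated_category = klinear_additive_category +
  assumes shift_functor: "is_functor C C \<lparr>fob = sho C n, farr = sha C n\<rparr>"
    and shift_add: "\<lbrakk>f \<in> mor C a b; g \<in> mor C a b\<rbrakk> \<Longrightarrow>
          sha C n (aadd C f g) = aadd C (sha C n f) (sha C n g)"
    and shift_scale: "\<lbrakk>k \<in> carrier K; f \<in> Arr C\<rbrakk> \<Longrightarrow> sha C n (ascale C k f) = ascale C k (sha C n f)"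
    and sho_0: "a \<in> Ob C \<Longrightarrow> sho C 0 a = a"
    and sha_0: "f \<in> Arr C \<Longrightarrow> sha C 0 f = f"
    and sho_sho: "a \<in> Ob C \<Longrightarrow> sho C n (sho C m a) = sho C (n + m) a"
    and sha_sha: "f \<in> Arr C \<Longrightarrow> sha C n (sha C m f) = sha C (n + m) f"
    and dist_triangle: "t \<in> Dist C \<Longrightarrow> triangle C t"
    and TR1_id: "\<lbrakk>a \<in> Ob C; zero_object C z\<rbrakk> \<Longrightarrow>
          (idn C a, azero C a z, azero C z (sho C 1 a)) \<in> Dist C"
    and TR1_iso: "\<lbrakk>t \<in> Dist C; triangle_iso C t t'\<rbrakk> \<Longrightarrow> t' \<in> Dist C"
    and TR1_cone: "f \<in> Arr C \<Longrightarrow> \<exists>g h. (f, g, h) \<in> Dist C"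
    and TR2: "triangle C (f, g, h) \<Longrightarrow>
          (f, g, h) \<in> Dist C \<longleftrightarrow>
          (g, h, \<ominus>\<^bsub>mor_space C (sho C 1 (Dom C f)) (sho C 1 (Cod C f))\<^esub> sha C 1 f) \<in> Dist C"
    and TR3: "\<lbrakk>(f, g, h) \<in> Dist C; (f', g', h') \<in> Dist C;
          u \<in> mor C (Dom C f) (Dom C f'); v \<in> mor C (Cod C f) (Cod C f'); v \<star> f = f' \<star> u\<rbrakk> \<Longrightarrow>
          \<exists>w. triangle_map C (f, g, h) (f', g', h') (u, v, w)"
    and TR4: "\<lbrakk>f \<in> mor C x y; g \<in> mor C y z;
          (f, p1, d1) \<in> Dist C; (g \<star> f, p2, d2) \<in> Dist C; (g, p3, d3) \<in> Dist C\<rbrakk> \<Longrightarrow>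
          \<exists>a b. (a, b, sha C 1 p1 \<star> d3) \<in> Dist C \<and>
            triangle_map C (f, p1, d1) (g \<star> f, p2, d2) (idn C x, g, a) \<and>
            triangle_map C (g \<star> f, p2, d2) (g, p3, d3) (f, idn C z, b)"


section \<open>Strictly full triangulated subcategories and Verdier quotients\<close>

definition full_subcategory :: "('o, 'm, 'k) tricat \<Rightarrow> 'o set \<Rightarrow> ('o, 'm, 'k) tricat" where
  "full_subcategory C S =
     C\<lparr>Ob := S,
       Arr := {f \<in> Arr C. Dom C f \<in> S \<and> Cod C f \<in> S},
       Dist := {(f, g, h). (f, g, h) \<in> Dist C \<and> Dom C f \<in> S \<and> Cod C f \<in> S \<and> Cod C g \<in> S}\<rparr>"

definition strictly_full_triangulated_subcategory :: "('o, 'm, 'k) tricat \<Rightarrow> 'o set \<Rightarrow> bool" where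
  "strictly_full_triangulated_subcategory C S \<longleftrightarrow>
     S \<subseteq> Ob C \<and>
     (\<exists>z \<in> S. zero_object C z) \<and>
     (\<forall>u. is_iso C u \<and> Dom C u \<in> S \<longrightarrow> Cod C u \<in> S) \<and>
     (\<forall>a \<in> S. \<forall>n. sho C n a \<in> S) \<and>
     (\<forall>f g h. (f, g, h) \<in> Dist C \<and> Dom C f \<in> S \<and> Cod C f \<in> S \<longrightarrow> Cod C g \<in> S)"

definition inclusion_functor :: "('o, 'm, 'o, 'm) functor_data" where
  "inclusion_functor = \<lparr>fob = (\<lambda>a. a), farr = (\<lambda>f. f)\<rparr>"

text \<open>
  The Verdier quotient by the calculus of fractions: its arrows from \<open>a\<close> to \<open>b\<close> are the
  equivalence classes of roofs \<open>a \<leftarrow> z \<rightarrow> b\<close>, written as pairs \<open>(s, f)\<close>, whose left leg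
  \<open>s\<close> has its cone in \<open>S\<close>.  Two roofs are equivalent if they are dominated by a common third one.
\<close>

definition cone_in :: "('o, 'm, 'k) tricat \<Rightarrow> 'o set \<Rightarrow> 'm set" where
  "cone_in C S = {s. \<exists>g h. (s, g, h) \<in> Dist C \<and> Cod C g \<in> S}"

definition roofs :: "('o, 'm, 'k) tricat \<Rightarrow> 'o set \<Rightarrow> 'o \<Rightarrow> 'o \<Rightarrow> ('m \<times> 'm) set" where
  "roofs C S a b = {(s, f). s \<in> cone_in C S \<and> Cod C s = a \<and> f \<in> mor C (Dom C s) b}"

definition roof_class :: "('o, 'm, 'k) tricat \<Rightarrow> 'o set \<Rightarrow> 'm \<times> 'm \<Rightarrow> ('m \<times> 'm) set" where
  "roof_class C S = (\<lambda>(s, f).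
     {(s', f') \<in> roofs C S (Cod C s) (Cod C f).
        \<exists>w \<in> Ob C. \<exists>u \<in> mor C w (Dom C s). \<exists>u' \<in> mor C w (Dom C s').
          s \<star>\<^bsub>C\<^esub> u = s' \<star>\<^bsub>C\<^esub> u' \<and> f \<star>\<^bsub>C\<^esub> u = f' \<star>\<^bsub>C\<^esub> u' \<and> s \<star>\<^bsub>C\<^esub> u \<in> cone_in C S})"

text \<open>
  Operations on arrows are given on representatives, each result being the union of the classes
  obtained from all admissible choices (all these classes coincide).  To compose, complete
  \<open>f\<close> and \<open>t\<close> to a commutative square \<open>f \<star> r = t \<star> l\<close> with \<open>r\<close> having its cone in \<open>S\<close>; to add,
  use representatives with a common left leg.
\<close>

definition roof_category :: "('o, 'm, 'k) tricat \<Rightarrow> 'o set \<Rightarrow> ('o, ('m \<times> 'm) set, 'k) tricat" where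
  "roof_category C S =
     \<lparr>Ob = Ob C,
      Arr = {roof_class C S p | p a b. a \<in> Ob C \<and> b \<in> Ob C \<and> p \<in> roofs C S a b},
      Dom = (\<lambda>F. Cod C (fst (SOME p. p \<in> F))),
      Cod = (\<lambda>F. Cod C (snd (SOME p. p \<in> F))),
      idn = (\<lambda>a. roof_class C S (idn C a, idn C a)),
      cmp = (\<lambda>G F. \<Union> {roof_class C S (s \<star>\<^bsub>C\<^esub> r, g \<star>\<^bsub>C\<^esub> l) | s f t g r l.
               (s, f) \<in> F \<and> (t, g) \<in> G \<and> r \<in> cone_in C S \<and> Cod C r = Dom C s \<and>
               l \<in> mor C (Dom C r) (Dom C t) \<and> f \<star>\<^bsub>C\<^esub> r = t \<star>\<^bsub>C\<^esub> l}),
      azero = (\<lambda>a b. roof_class C S (idn C a, azero C a b)),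
      aadd = (\<lambda>F G. \<Union> {roof_class C S (s, aadd C f g) | s f g. (s, f) \<in> F \<and> (s, g) \<in> G}),
      ascale = (\<lambda>k F. \<Union> {roof_class C S (s, ascale C k f) | s f. (s, f) \<in> F}),
      sho = sho C,
      sha = (\<lambda>n F. \<Union> {roof_class C S (sha C n s, sha C n f) | s f. (s, f) \<in> F}),
      Dist = {}\<rparr>"

definition quotient_functor ::
    "('o, 'm, 'k) tricat \<Rightarrow> 'o set \<Rightarrow> ('o, 'm, 'o, ('m \<times> 'm) set) functor_data" where
  "quotient_functor C S = \<lparr>fob = (\<lambda>a. a), farr = (\<lambda>f. roof_class C S (idn C (Dom C f), f))\<rparr>"

text \<open>
  A triangle of the quotient is distinguished if it is isomorphic to the image of a distinguished
  triangle (\<^const>\<open>triangle_iso\<close> does not depend on the field \<open>Dist\<close>).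
\<close>

definition verdier_quotient :: "('o, 'm, 'k) tricat \<Rightarrow> 'o set \<Rightarrow> ('o, ('m \<times> 'm) set, 'k) tricat" where
  "verdier_quotient C S = (let q = farr (quotient_functor C S) in
     (roof_category C S)
       \<lparr>Dist := {t. \<exists>f g h. (f, g, h) \<in> Dist C \<and> triangle_iso (roof_category C S) (q f, q g, q h) t}\<rparr>)"


section \<open>Adjoints\<close>

definition is_right_adjoint ::
    "('o1, 'm1, 'k1) tricat \<Rightarrow> ('o2, 'm2, 'k2) tricat \<Rightarrow>
     ('o1, 'm1, 'o2, 'm2) functor_data \<Rightarrow> ('o2, 'm2, 'o1, 'm1) functor_data \<Rightarrow> bool" where
  "is_right_adjoint C D F G \<longleftrightarrow>
     is_functor C D F \<and> is_functor D C G \<and>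
     (\<exists>\<Phi>. (\<forall>a \<in> Ob C. \<forall>d \<in> Ob D.
             bij_betw (\<Phi> a d) (mor D (fob F a) d) (mor C a (fob G d))) \<and>
          (\<forall>a \<in> Ob C. \<forall>a' \<in> Ob C. \<forall>d \<in> Ob D. \<forall>d' \<in> Ob D.
           \<forall>u \<in> mor C a' a. \<forall>x \<in> mor D (fob F a) d. \<forall>v \<in> mor D d d'.
             \<Phi> a' d' (v \<star>\<^bsub>D\<^esub> x \<star>\<^bsub>D\<^esub> farr F u) = farr G v \<star>\<^bsub>C\<^esub> \<Phi> a d x \<star>\<^bsub>C\<^esub> u))"


section \<open>Grothendieck groups\<close>

definition K0_relations :: "('o, 'm, 'k) tricat \<Rightarrow> ('o \<Rightarrow>\<^sub>0 int) set" where
  "K0_relations C = {frag_of (Cod C f) - frag_of (Dom C f) - frag_of (Cod C g) | f g h. (f, g, h) \<in> Dist C}"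

definition K0 :: "('o, 'm, 'k) tricat \<Rightarrow> ('o \<Rightarrow>\<^sub>0 int) set monoid" where
  "K0 C = free_Abelian_group (Ob C) Mod generate (free_Abelian_group (Ob C)) (K0_relations C)"

definition K0_class :: "('o, 'm, 'k) tricat \<Rightarrow> 'o \<Rightarrow> ('o \<Rightarrow>\<^sub>0 int) set" where
  "K0_class C a = generate (free_Abelian_group (Ob C)) (K0_relations C) #>\<^bsub>free_Abelian_group (Ob C)\<^esub> frag_of a"

definition nonzero_degrees :: "('o, 'm, 'k) tricat \<Rightarrow> 'o \<Rightarrow> 'o \<Rightarrow> int set" where
  "nonzero_degrees C a b = {n. mor C a (sho C n b) \<noteq> {azero C a (sho C n b)}}"

definition total_hom_finite :: "('k, 'r) ring_scheme \<Rightarrow> ('o, 'm, 'k) tricat \<Rightarrow> bool" where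
  "total_hom_finite K C \<longleftrightarrow> (\<forall>a \<in> Ob C. \<forall>b \<in> Ob C.
     finite (nonzero_degrees C a b) \<and>
     (\<forall>n. vectorspace.fin_dim K (mor_space C a (sho C n b))))"

definition euler_number :: "('k, 'r) ring_scheme \<Rightarrow> ('o, 'm, 'k) tricat \<Rightarrow> 'o \<Rightarrow> 'o \<Rightarrow> int" where
  "euler_number K C a b = (\<Sum>n \<in> nonzero_degrees C a b.
     (if even n then 1 else - 1) * int (vectorspace.dim K (mor_space C a (sho C n b))))"

definition is_euler_form ::
    "('k, 'r) ring_scheme \<Rightarrow> ('o, 'm, 'k) tricat \<Rightarrow>
     (('o \<Rightarrow>\<^sub>0 int) set \<Rightarrow> ('o \<Rightarrow>\<^sub>0 int) set \<Rightarrow> int) \<Rightarrow> bool" where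
  "is_euler_form K C \<chi> \<longleftrightarrow>
     (\<forall>y \<in> carrier (K0 C). (\<lambda>x. \<chi> x y) \<in> hom (K0 C) integer_group) \<and>
     (\<forall>x \<in> carrier (K0 C). (\<lambda>y. \<chi> x y) \<in> hom (K0 C) integer_group) \<and>
     (\<forall>a \<in> Ob C. \<forall>b \<in> Ob C. \<chi> (K0_class C a) (K0_class C b) = euler_number K C a b)"

definition euler_form_well_defined :: "('k, 'r) ring_scheme \<Rightarrow> ('o, 'm, 'k) tricat \<Rightarrow> bool" where
  "euler_form_well_defined K C \<longleftrightarrow> total_hom_finite K C \<and> (\<exists>\<chi>. is_euler_form K C \<chi>)"

text \<open>Well-definedness determines the form on the carrier of \<^term>\<open>K0 C\<close>, as the classes of objects
  generate this group.\<close>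

definition euler_form ::
    "('k, 'r) ring_scheme \<Rightarrow> ('o, 'm, 'k) tricat \<Rightarrow> ('o \<Rightarrow>\<^sub>0 int) set \<Rightarrow> ('o \<Rightarrow>\<^sub>0 int) set \<Rightarrow> int" where
  "euler_form K C = (SOME \<chi>. is_euler_form K C \<chi>)"

definition left_radical :: "('k, 'r) ring_scheme \<Rightarrow> ('o, 'm, 'k) tricat \<Rightarrow> ('o \<Rightarrow>\<^sub>0 int) set set" where
  "left_radical K C = {x \<in> carrier (K0 C). \<forall>y \<in> carrier (K0 C). euler_form K C x y = 0}"

definition right_radical :: "('k, 'r) ring_scheme \<Rightarrow> ('o, 'm, 'k) tricat \<Rightarrow> ('o \<Rightarrow>\<^sub>0 int) set set" where
  "right_radical K C = {y \<in> carrier (K0 C). \<forall>x \<in> carrier (K0 C). euler_form K C x y = 0}"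

definition numerical_K0_exists :: "('k, 'r) ring_scheme \<Rightarrow> ('o, 'm, 'k) tricat \<Rightarrow> bool" where
  "numerical_K0_exists K C \<longleftrightarrow> euler_form_well_defined K C \<and> left_radical K C = right_radical K C"

definition K0_num ::
    "('k, 'r) ring_scheme \<Rightarrow> ('o, 'm, 'k) tricat \<Rightarrow> ('o \<Rightarrow>\<^sub>0 int) set set monoid" where
  "K0_num K C = K0 C Mod left_radical K C"

definition K0_num_class ::
    "('k, 'r) ring_scheme \<Rightarrow> ('o, 'm, 'k) tricat \<Rightarrow> 'o \<Rightarrow> ('o \<Rightarrow>\<^sub>0 int) set set" where
  "K0_num_class K C a = left_radical K C #>\<^bsub>K0 C\<^esub> K0_class C a"

definition induces_on_K0_num ::
    "('k, 'r) ring_scheme \<Rightarrow> ('o1, 'm1, 'k) tricat \<Rightarrow> ('o2, 'm2, 'k) tricat \<Rightarrow>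
     ('o1, 'm1, 'o2, 'm2) functor_data \<Rightarrow>
     (('o1 \<Rightarrow>\<^sub>0 int) set set \<Rightarrow> ('o2 \<Rightarrow>\<^sub>0 int) set set) \<Rightarrow> bool" where
  "induces_on_K0_num K C D F \<phi> \<longleftrightarrow>
     \<phi> \<in> hom (K0_num K C) (K0_num K D) \<and>
     (\<forall>a \<in> Ob C. \<phi> (K0_num_class K C a) = K0_num_class K D (fob F a))"

end

theory Submission
  imports Defs
begin

text \<open>
  Let \<open>r b \<rightarrow> b \<rightarrow> c b\<close> be a triangle on the counit of the adjunction for \<open>i\<close>.  Then \<open>r b\<close> lies in \<open>S\<close>
  and \<open>c b\<close> is right orthogonal to \<open>S\<close>, so that homs into \<open>b[n]\<close> in the quotient are homs into
  \<open>c b[n]\<close> in \<open>T\<close>.  Writing \<open>\<chi>\<close> for the Euler forms, this gives \<open>\<chi>\<^sub>Q(a, b) = \<chi>\<^sub>T(a, c b)\<close>, and for \<open>a\<close>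
  in \<open>S\<close> also \<open>\<chi>\<^sub>T(a, c b) = 0\<close> and \<open>\<chi>\<^sub>T(a, b) = \<chi>\<^sub>S(a, r b)\<close>; hence \<open>i\<close> and \<open>q\<close> preserve left radicals
  and \<open>q i\<close> vanishes numerically.  If a class \<open>x\<close> of \<open>T\<close> becomes radical in the quotient, then \<open>c x\<close> lies
  in the right radical of \<open>T\<close>, which is the left one, so \<open>x\<close> agrees numerically with \<open>r x\<close>, which comes
  from \<open>S\<close>.
\<close>

section \<open>Free Abelian groups and vector spaces\<close>

text \<open>Passing from \<open>b\<close> to \<open>c b\<close> works because an arrow into an
  object right orthogonal to \<open>S\<close> extends uniquely along any arrow whose cone lies in
  \<open>S\<close>: the obstructions to existence and to uniqueness are both maps out of objects of
  \<open>S\<close>. An equivalence class of roofs thereby becomes a single arrow of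
  \<open>T\<close>, and the linear structure of hom sets in the quotient is read off from that of
  \<open>T\<close>. The objects \<open>r b\<close> and \<open>c b\<close> are mere choices, one for
  each \<open>b\<close>. They are extended linearly to formal combinations of objects, and every
  equality in a numerical group is tested by pairing such combinations with objects; this replaces a
  verification that the choices respect the triangle relations. As \<open>c\<close> acts on the
  second argument of the Euler form, sides have to be changed twice: in the quotient, to read the
  triviality of \<open>x\<close> in the second argument, and in \<open>T\<close>, to bring the
  triviality of \<open>c x\<close> back to the first.\<close>

text \<open>The integers are encoded as the free Abelian group on one generator, so that additivity is
  inherited from \<^const>\<open>frag_extend\<close>.\<close>

definition frag_eval :: "('a \<Rightarrow> int) \<Rightarrow> ('a \<Rightarrow>\<^sub>0 int) \<Rightarrow> int" where
  "frag_eval h x = poly_mapping.lookup (frag_extend (\<lambda>a. frag_cmul (h a) (frag_of ())) x) ()"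

lemma frag_eval_0 [simp]: "frag_eval h 0 = 0"
  by (simp add: frag_eval_def)

lemma frag_eval_of [simp]: "frag_eval h (frag_of a) = h a"
  by (simp add: frag_eval_def)

lemma frag_eval_diff [simp]: "frag_eval h (x - y) = frag_eval h x - frag_eval h y"
  by (simp add: frag_eval_def frag_extend_diff lookup_minus)

lemma frag_eval_add_fun: "frag_eval (\<lambda>a. h a + k a) x = frag_eval h x + frag_eval k x"
  using subset_UNIV[of "Poly_Mapping.keys x"] by (induction x rule: frag_induction) auto

lemma frag_eval_zero_fun: "frag_eval (\<lambda>a. 0) x = 0"
  using subset_UNIV[of "Poly_Mapping.keys x"] by (induction x rule: frag_induction) auto

lemma frag_eval_frag_extend:
  "frag_eval h (frag_extend (\<lambda>a. frag_of (r a)) x) = frag_eval (\<lambda>a. h (r a)) x"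
  using subset_UNIV[of "Poly_Mapping.keys x"]
  by (induction x rule: frag_induction) (auto simp: frag_extend_diff)

lemma frag_eval_cong:
  assumes "Poly_Mapping.keys x \<subseteq> S" "\<And>a. a \<in> S \<Longrightarrow> h a = k a"
  shows "frag_eval h x = frag_eval k x"
  by (rule free_Abelian_group_induct[OF assms(1)]) (auto simp: assms(2))

lemma keys_frag_extend_of:
  assumes "Poly_Mapping.keys x \<subseteq> A" "\<And>a. a \<in> A \<Longrightarrow> r a \<in> B"
  shows "Poly_Mapping.keys (frag_extend (\<lambda>a. frag_of (r a)) x) \<subseteq> B"
  using keys_frag_extend[of "\<lambda>a. frag_of (r a)" x] assms by auto

text \<open>Reduces the Euler form on arbitrary classes to its values on objects.\<close>

lemma hom_free_Abelian_group_integer: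
  assumes "h \<in> hom (free_Abelian_group S) integer_group" "Poly_Mapping.keys x \<subseteq> S"
  shows "h x = frag_eval (\<lambda>a. h (frag_of a)) x"
proof (rule free_Abelian_group_induct[OF assms(2)])
  have "h (\<one>\<^bsub>free_Abelian_group S\<^esub>) = \<one>\<^bsub>integer_group\<^esub>"
    using assms(1) by (intro hom_one) auto
  then show "h 0 = frag_eval (\<lambda>a. h (frag_of a)) 0" by simp
next
  fix x y
  assume xy: "Poly_Mapping.keys x \<subseteq> S" "Poly_Mapping.keys y \<subseteq> S"
    "h x = frag_eval (\<lambda>a. h (frag_of a)) x" "h y = frag_eval (\<lambda>a. h (frag_of a)) y"
  have "x - y \<in> carrier (free_Abelian_group S)"
    using xy by (auto dest: subsetD[OF keys_diff])
  then have "h ((x - y) + y) = h (x - y) + h y"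
    using hom_mult[OF assms(1), of "x - y" y] xy by simp
  with xy show "h (x - y) = frag_eval (\<lambda>a. h (frag_of a)) (x - y)" by simp
qed simp

text \<open>The intended \<open>W\<close> is a hom set of the quotient with its operations on roofs,
  for which no vector space axioms are available. They are carried over along \<open>h\<close>; only
  then does the dimension theorem for linear maps apply.\<close>

lemma vectorspace_dim_transport:
  assumes V: "vectorspace K V" and fin: "vectorspace.fin_dim K V"
    and bij: "bij_betw h (carrier V) (carrier W)"
    and add: "\<And>u v. \<lbrakk>u \<in> carrier V; v \<in> carrier V\<rbrakk> \<Longrightarrow> h (u \<oplus>\<^bsub>V\<^esub> v) = h u \<oplus>\<^bsub>W\<^esub> h v"
    and scale: "\<And>k v. \<lbrakk>k \<in> carrier K; v \<in> carrier V\<rbrakk> \<Longrightarrow> h (k \<odot>\<^bsub>V\<^esub> v) = k \<odot>\<^bsub>W\<^esub> h v"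
    and zero: "h \<zero>\<^bsub>V\<^esub> = \<zero>\<^bsub>W\<^esub>"
  shows "vectorspace.dim K W = vectorspace.dim K V"
proof -
  have VM: "module K V" and K: "cring K" "field K"
    using V by (simp_all add: vectorspace_def module_def)
  interpret V: module K V by (rule VM)
  have im: "h ` carrier V = carrier W" and inj: "inj_on h (carrier V)"
    using bij by (auto simp: bij_betw_def)
  have hW: "h v \<in> carrier W" if "v \<in> carrier V" for v
    using im that by blast
  have ex: thesis if "w \<in> carrier W" "\<And>v. \<lbrakk>v \<in> carrier V; w = h v\<rbrakk> \<Longrightarrow> thesis" for w thesis
    using im that by blast
  \<comment> \<open>Read from right to left, these equations pull every operation of
    \<open>W\<close> on images back into \<open>V\<close>.\<close>
  note h_simps = add[symmetric] scale[symmetric] zero[symmetric]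
  have "abelian_group W"
  proof (rule abelian_groupI)
    fix x y z assume x: "x \<in> carrier W" and y: "y \<in> carrier W" and z: "z \<in> carrier W"
    obtain u where u: "u \<in> carrier V" "x = h u" by (rule ex[OF x])
    obtain v where v: "v \<in> carrier V" "y = h v" by (rule ex[OF y])
    obtain w where w: "w \<in> carrier V" "z = h w" by (rule ex[OF z])
    show "x \<oplus>\<^bsub>W\<^esub> y \<oplus>\<^bsub>W\<^esub> z = x \<oplus>\<^bsub>W\<^esub> (y \<oplus>\<^bsub>W\<^esub> z)"
      using u v w by (simp add: h_simps V.a_assoc)
  next
    fix x y assume x: "x \<in> carrier W" and y: "y \<in> carrier W"
    obtain u where u: "u \<in> carrier V" "x = h u" by (rule ex[OF x])
    obtain v where v: "v \<in> carrier V" "y = h v" by (rule ex[OF y])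
    show "x \<oplus>\<^bsub>W\<^esub> y \<in> carrier W" "x \<oplus>\<^bsub>W\<^esub> y = y \<oplus>\<^bsub>W\<^esub> x"
      using u v by (simp_all add: h_simps hW V.a_comm)
  next
    fix x assume x: "x \<in> carrier W"
    obtain u where u: "u \<in> carrier V" "x = h u" by (rule ex[OF x])
    show "\<zero>\<^bsub>W\<^esub> \<oplus>\<^bsub>W\<^esub> x = x"
      using u by (simp add: h_simps)
    show "\<exists>y \<in> carrier W. y \<oplus>\<^bsub>W\<^esub> x = \<zero>\<^bsub>W\<^esub>"
      by (rule bexI[of _ "h (\<ominus>\<^bsub>V\<^esub> u)"]) (use u in \<open>simp_all add: h_simps hW V.l_neg\<close>)
  next
    show "\<zero>\<^bsub>W\<^esub> \<in> carrier W"
      by (simp add: h_simps hW)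
  qed
  with K(1) have "module K W"
  proof (rule moduleI)
    fix k l x assume kl: "k \<in> carrier K" "l \<in> carrier K" and x: "x \<in> carrier W"
    obtain u where u: "u \<in> carrier V" "x = h u" by (rule ex[OF x])
    show "(k \<oplus>\<^bsub>K\<^esub> l) \<odot>\<^bsub>W\<^esub> x = k \<odot>\<^bsub>W\<^esub> x \<oplus>\<^bsub>W\<^esub> l \<odot>\<^bsub>W\<^esub> x"
      "(k \<otimes>\<^bsub>K\<^esub> l) \<odot>\<^bsub>W\<^esub> x = k \<odot>\<^bsub>W\<^esub> (l \<odot>\<^bsub>W\<^esub> x)"
      using kl u by (simp_all add: h_simps V.smult_l_distr V.smult_assoc1)
  next
    fix k x y assume k: "k \<in> carrier K" and x: "x \<in> carrier W" and y: "y \<in> carrier W"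
    obtain u where u: "u \<in> carrier V" "x = h u" by (rule ex[OF x])
    obtain v where v: "v \<in> carrier V" "y = h v" by (rule ex[OF y])
    show "k \<odot>\<^bsub>W\<^esub> (x \<oplus>\<^bsub>W\<^esub> y) = k \<odot>\<^bsub>W\<^esub> x \<oplus>\<^bsub>W\<^esub> k \<odot>\<^bsub>W\<^esub> y"
      using k u v by (simp add: h_simps V.smult_r_distr)
  next
    fix k x assume k: "k \<in> carrier K" and x: "x \<in> carrier W"
    obtain u where u: "u \<in> carrier V" "x = h u" by (rule ex[OF x])
    show "k \<odot>\<^bsub>W\<^esub> x \<in> carrier W"
      using k u by (simp add: h_simps hW)
  next
    fix x assume x: "x \<in> carrier W"
    obtain u where u: "u \<in> carrier V" "x = h u" by (rule ex[OF x])
    show "\<one>\<^bsub>K\<^esub> \<odot>\<^bsub>W\<^esub> x = x"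
      using u by (simp add: h_simps)
  qed
  then have W: "vectorspace K W"
    using K by (simp add: vectorspace_def)
  have "h \<in> module_hom K V W"
    using hW add scale by (auto simp: module_hom_def)
  then have "linear_map K V W h"
    using V W by (simp add: linear_map_def mod_hom_def mod_hom_axioms_def vectorspace_def)
  from linear_map.dim_eq[OF this fin inj im] show ?thesis by simp
qed

section \<open>Numerical Grothendieck groups\<close>

text \<open>Besides the existence of the numerical group, only the ends of distinguished triangles
  are constrained, so that the locale applies to the Verdier quotient directly from its construction
  by roofs.\<close>

locale numerical_K0 =
  fixes K :: "('k, 'r) ring_scheme" and C :: "('o, 'm, 'k) tricat"
  assumes K0_num_exists: "numerical_K0_exists K C"
    and Dist_ends: "(f, g, h) \<in> Dist C \<Longrightarrow> Dom C f \<in> Ob C \<and> Cod C f \<in> Ob C \<and> Cod C g \<in> Ob C"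
begin

abbreviation "F \<equiv> free_Abelian_group (Ob C)"
abbreviation "R \<equiv> generate F (K0_relations C)"
abbreviation "E \<equiv> euler_number K C"
abbreviation "\<chi> \<equiv> euler_form K C"
abbreviation "L \<equiv> left_radical K C"

definition cls :: "('o \<Rightarrow>\<^sub>0 int) \<Rightarrow> ('o \<Rightarrow>\<^sub>0 int) set" where
  "cls x = R #>\<^bsub>F\<^esub> x"

text \<open>Elements of the numerical group are handled through formal combinations of objects;
  being trivial then becomes a system of linear equations in Euler numbers.\<close>

definition num_cls :: "('o \<Rightarrow>\<^sub>0 int) \<Rightarrow> ('o \<Rightarrow>\<^sub>0 int) set set" where
  "num_cls x = L #>\<^bsub>K0 C\<^esub> cls x"

lemma K0_relations_carrier: "K0_relations C \<subseteq> carrier F"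
proof
  fix x assume "x \<in> K0_relations C"
  then obtain f g h where "(f, g, h) \<in> Dist C"
    and x: "x = frag_of (Cod C f) - frag_of (Dom C f) - frag_of (Cod C g)"
    unfolding K0_relations_def by blast
  with Dist_ends[of f g h] show "x \<in> carrier F"
    by (auto dest!: subsetD[OF keys_diff])
qed

lemma normal_R: "R \<lhd> F"
  by (rule comm_group.subgroup_imp_normal[OF abelian_free_Abelian_group
    group.generate_is_subgroup[OF group_free_Abelian_group K0_relations_carrier]])

lemma comm_group_K0: "comm_group (K0 C)"
  unfolding K0_def
  by (rule comm_group.abelian_FactGroup[OF abelian_free_Abelian_group normal_imp_subgroup[OF normal_R]])

lemma cls_hom: "cls \<in> hom F (K0 C)"
  unfolding K0_def cls_def[abs_def] by (rule normal.r_coset_hom_Mod[OF normal_R])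

lemma carrier_K0: "carrier (K0 C) = cls ` carrier F"
  by (auto simp: K0_def cls_def FactGroup_def RCOSETS_def)

lemma euler_form: "is_euler_form K C \<chi>"
proof -
  obtain c where "is_euler_form K C c"
    using K0_num_exists unfolding numerical_K0_exists_def euler_form_well_defined_def by blast
  then show ?thesis unfolding euler_form_def by (rule someI[of "is_euler_form K C"])
qed

lemma euler_form_left:
  assumes "Y \<in> carrier (K0 C)" "Poly_Mapping.keys x \<subseteq> Ob C"
  shows "\<chi> (cls x) Y = frag_eval (\<lambda>a. \<chi> (K0_class C a) Y) x"
proof -
  have "(\<lambda>x. \<chi> x Y) \<circ> cls \<in> hom F integer_group"
    using assms(1) euler_form unfolding is_euler_form_def
    by (intro hom_compose[OF cls_hom]) auto
  from hom_free_Abelian_group_integer[OF this assms(2)] show ?thesis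
    by (simp add: cls_def K0_class_def)
qed

lemma euler_form_right:
  assumes "Z \<in> carrier (K0 C)" "Poly_Mapping.keys y \<subseteq> Ob C"
  shows "\<chi> Z (cls y) = frag_eval (\<lambda>b. \<chi> Z (K0_class C b)) y"
proof -
  have "(\<lambda>y. \<chi> Z y) \<circ> cls \<in> hom F integer_group"
    using assms(1) euler_form unfolding is_euler_form_def
    by (intro hom_compose[OF cls_hom]) auto
  from hom_free_Abelian_group_integer[OF this assms(2)] show ?thesis
    by (simp add: cls_def K0_class_def)
qed

lemma K0_class_carrier: "a \<in> Ob C \<Longrightarrow> K0_class C a \<in> carrier (K0 C)"
  by (auto simp: carrier_K0 cls_def K0_class_def)

lemma euler_form_class_left:
  assumes "b \<in> Ob C" "Poly_Mapping.keys x \<subseteq> Ob C"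
  shows "\<chi> (cls x) (K0_class C b) = frag_eval (\<lambda>a. E a b) x"
  unfolding euler_form_left[OF K0_class_carrier[OF assms(1)] assms(2)]
  using euler_form assms unfolding is_euler_form_def by (intro frag_eval_cong) auto

lemma euler_form_class_right:
  assumes "a \<in> Ob C" "Poly_Mapping.keys y \<subseteq> Ob C"
  shows "\<chi> (K0_class C a) (cls y) = frag_eval (E a) y"
  unfolding euler_form_right[OF K0_class_carrier[OF assms(1)] assms(2)]
  using euler_form assms unfolding is_euler_form_def by (intro frag_eval_cong) auto

text \<open>The form is additive in its second argument and classes of objects generate
  \<open>K0 C\<close>, so it suffices to pair with objects.\<close>

lemma mem_left_radical:
  assumes "Poly_Mapping.keys x \<subseteq> Ob C"
  shows "cls x \<in> L \<longleftrightarrow> (\<forall>b \<in> Ob C. frag_eval (\<lambda>a. E a b) x = 0)"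
proof
  assume "cls x \<in> L"
  then show "\<forall>b \<in> Ob C. frag_eval (\<lambda>a. E a b) x = 0"
    using assms by (simp add: left_radical_def euler_form_class_left[symmetric] K0_class_carrier)
next
  have car: "cls x \<in> carrier (K0 C)"
    using assms by (auto simp: carrier_K0)
  assume "\<forall>b \<in> Ob C. frag_eval (\<lambda>a. E a b) x = 0"
  then have 0: "\<chi> (cls x) (K0_class C b) = 0" if "b \<in> Ob C" for b
    using assms that by (simp add: euler_form_class_left)
  have "\<chi> (cls x) (cls y) = 0" if "Poly_Mapping.keys y \<subseteq> Ob C" for y
    unfolding euler_form_right[OF car that]
    using frag_eval_cong[OF that, of "\<lambda>b. \<chi> (cls x) (K0_class C b)" "\<lambda>b. 0"]
    by (simp add: 0 frag_eval_zero_fun)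
  then show "cls x \<in> L"
    using car by (auto simp: left_radical_def carrier_K0)
qed

lemma mem_right_radical:
  assumes "Poly_Mapping.keys y \<subseteq> Ob C"
  shows "cls y \<in> right_radical K C \<longleftrightarrow> (\<forall>a \<in> Ob C. frag_eval (E a) y = 0)"
proof
  assume "cls y \<in> right_radical K C"
  then show "\<forall>a \<in> Ob C. frag_eval (E a) y = 0"
    using assms by (simp add: right_radical_def euler_form_class_right[symmetric] K0_class_carrier)
next
  have car: "cls y \<in> carrier (K0 C)"
    using assms by (auto simp: carrier_K0)
  assume "\<forall>a \<in> Ob C. frag_eval (E a) y = 0"
  then have 0: "\<chi> (K0_class C a) (cls y) = 0" if "a \<in> Ob C" for a
    using assms that by (simp add: euler_form_class_right)
  have "\<chi> (cls x) (cls y) = 0" if "Poly_Mapping.keys x \<subseteq> Ob C" for x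
    unfolding euler_form_left[OF car that]
    using frag_eval_cong[OF that, of "\<lambda>a. \<chi> (K0_class C a) (cls y)" "\<lambda>a. 0"]
    by (simp add: 0 frag_eval_zero_fun)
  then show "cls y \<in> right_radical K C"
    using car by (auto simp: right_radical_def carrier_K0)
qed

text \<open>The left radical is the intersection of the kernels of the homomorphisms
  \<open>\<lambda>x. \<chi> x y\<close>.\<close>

lemma normal_L: "L \<lhd> K0 C"
proof -
  interpret G: comm_group "K0 C" by (rule comm_group_K0)
  have hom: "(\<lambda>x. \<chi> x y) \<in> hom (K0 C) integer_group" if "y \<in> carrier (K0 C)" for y
    using euler_form that unfolding is_euler_form_def by blast
  have gh: "group_hom (K0 C) integer_group (\<lambda>x. \<chi> x y)" if "y \<in> carrier (K0 C)" for y
    using hom[OF that] by (auto simp: group_hom_def group_hom_axioms_def G.is_group)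
  have "subgroup L (K0 C)"
  proof (rule G.subgroupI)
    show "L \<subseteq> carrier (K0 C)" by (auto simp: left_radical_def)
    have "\<one>\<^bsub>K0 C\<^esub> \<in> L"
      using group_hom.hom_one[OF gh] by (simp add: left_radical_def)
    then show "L \<noteq> {}" by blast
  next
    fix a assume "a \<in> L"
    then show "inv\<^bsub>K0 C\<^esub> a \<in> L"
      using group_hom.hom_inv[OF gh] by (simp add: left_radical_def)
  next
    fix a b assume "a \<in> L" "b \<in> L"
    then show "a \<otimes>\<^bsub>K0 C\<^esub> b \<in> L"
      using group_hom.hom_mult[OF gh] by (simp add: left_radical_def)
  qed
  then show ?thesis by (rule G.subgroup_imp_normal)
qed

lemma group_K0_num: "group (K0_num K C)"
  unfolding K0_num_def by (rule normal.factorgroup_is_group[OF normal_L])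

lemma num_cls_hom: "num_cls \<in> hom F (K0_num K C)"
proof -
  have "(\<lambda>x. L #>\<^bsub>K0 C\<^esub> x) \<circ> cls \<in> hom F (K0_num K C)"
    unfolding K0_num_def by (rule hom_compose[OF cls_hom normal.r_coset_hom_Mod[OF normal_L]])
  then show ?thesis by (simp add: num_cls_def[abs_def] comp_def)
qed

lemma num_cls_surj: "carrier (K0_num K C) = num_cls ` carrier F"
  by (auto simp: K0_num_def num_cls_def FactGroup_def RCOSETS_def carrier_K0)

lemma num_cls_of: "num_cls (frag_of a) = K0_num_class K C a"
  by (simp add: num_cls_def K0_num_class_def cls_def K0_class_def)

lemma num_cls_diff:
  assumes "Poly_Mapping.keys x \<subseteq> Ob C" "Poly_Mapping.keys y \<subseteq> Ob C"
  shows "num_cls x = num_cls y \<longleftrightarrow> num_cls (x - y) = \<one>\<^bsub>K0_num K C\<^esub>"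
proof -
  interpret G: group "K0_num K C" by (rule group_K0_num)
  have xy: "Poly_Mapping.keys (x - y) \<subseteq> Ob C"
    using assms by (auto dest: subsetD[OF keys_diff])
  have car: "num_cls z \<in> carrier (K0_num K C)" if "Poly_Mapping.keys z \<subseteq> Ob C" for z
    using that by (auto simp: num_cls_surj)
  have "num_cls x = num_cls (x - y) \<otimes>\<^bsub>K0_num K C\<^esub> num_cls y"
    using hom_mult[OF num_cls_hom, of "x - y" y] xy assms by simp
  then show ?thesis
    using car[OF xy] car[OF assms(2)] G.r_cancel_one[of "num_cls y" "num_cls (x - y)"] by simp
qed

lemma num_cls_eq_one_left:
  assumes "Poly_Mapping.keys x \<subseteq> Ob C"
  shows "num_cls x = \<one>\<^bsub>K0_num K C\<^esub> \<longleftrightarrow> (\<forall>b \<in> Ob C. frag_eval (\<lambda>a. E a b) x = 0)"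
proof -
  interpret N: normal L "K0 C" by (rule normal_L)
  have "cls x \<in> carrier (K0 C)"
    using assms by (auto simp: carrier_K0)
  then have "num_cls x = \<one>\<^bsub>K0_num K C\<^esub> \<longleftrightarrow> cls x \<in> L"
    unfolding num_cls_def K0_num_def
    using N.coset_join1[OF _ _ N.subgroup_axioms] N.coset_join2[OF _ N.subgroup_axioms] by auto
  with mem_left_radical[OF assms] show ?thesis by simp
qed

text \<open>Here the agreement of the two radicals enters: the group is formed with the left one,
  yet triviality may also be tested in the second argument.\<close>

lemma num_cls_eq_one_right:
  assumes "Poly_Mapping.keys x \<subseteq> Ob C"
  shows "num_cls x = \<one>\<^bsub>K0_num K C\<^esub> \<longleftrightarrow> (\<forall>a \<in> Ob C. frag_eval (E a) x = 0)"
  using num_cls_eq_one_left[OF assms] mem_left_radical[OF assms] mem_right_radical[OF assms]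
    K0_num_exists unfolding numerical_K0_exists_def by simp

text \<open>Instead of a long exact Hom sequence, this uses that the Euler form is well defined on
  \<open>K0 C\<close>, where the combination attached to a triangle is trivial.\<close>

lemma euler_number_triangle:
  assumes d: "(f, g, h) \<in> Dist C" and x: "x \<in> Ob C"
  shows "E (Cod C f) x = E (Dom C f) x + E (Cod C g) x"
    and "E x (Cod C f) = E x (Dom C f) + E x (Cod C g)"
proof -
  let ?r = "frag_of (Cod C f) - frag_of (Dom C f) - frag_of (Cod C g)"
  interpret N: normal R F by (rule normal_R)
  have "?r \<in> K0_relations C"
    using d unfolding K0_relations_def by blast
  then have "?r \<in> R" by (rule generate.incl)
  then have r: "?r \<in> carrier F"
    using N.subset by blast
  then have "cls ?r = R"
    unfolding cls_def using \<open>?r \<in> R\<close> by (rule N.coset_join2[OF _ N.subgroup_axioms])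
  interpret GG: comm_group "K0 C" by (rule comm_group_K0)
  have "cls ?r = \<one>\<^bsub>K0 C\<^esub>"
    using \<open>cls ?r = R\<close> by (simp add: K0_def)
  moreover have "\<chi> \<one>\<^bsub>K0 C\<^esub> (K0_class C x) = 0" "\<chi> (K0_class C x) \<one>\<^bsub>K0 C\<^esub> = 0"
    using euler_form K0_class_carrier[OF x]
      hom_one[of "\<lambda>z. \<chi> z (K0_class C x)", OF _ GG.is_group group_integer_group]
      hom_one[of "\<lambda>z. \<chi> (K0_class C x) z", OF _ GG.is_group group_integer_group]
    unfolding is_euler_form_def by simp_all
  ultimately have "frag_eval (\<lambda>a. E a x) ?r = 0" "frag_eval (E x) ?r = 0"
    using euler_form_class_left[OF x, of ?r] euler_form_class_right[OF x, of ?r] r by auto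
  then show "E (Cod C f) x = E (Dom C f) x + E (Cod C g) x"
    and "E x (Cod C f) = E x (Dom C f) + E x (Cod C g)"
    by auto
qed

end

text \<open>Inclusion and quotient functor are the identity on objects, so one formal combination
  \<open>x\<close> represents a class on both sides. The map picks any representative; by
  \<open>ker\<close> the choice does not matter.\<close>

lemma induced_hom_K0_num:
  fixes K :: "('k, 'r) ring_scheme"
    and C :: "('o, 'm, 'k) tricat" and D :: "('o, 'n, 'k) tricat"
  assumes C: "numerical_K0 K C" and D: "numerical_K0 K D"
    and Ob: "Ob C \<subseteq> Ob D"
    and ker: "\<And>x. \<lbrakk>Poly_Mapping.keys x \<subseteq> Ob C; numerical_K0.num_cls K C x = \<one>\<^bsub>K0_num K C\<^esub>\<rbrakk> \<Longrightarrow>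
      numerical_K0.num_cls K D x = \<one>\<^bsub>K0_num K D\<^esub>"
  shows "\<exists>\<phi> \<in> hom (K0_num K C) (K0_num K D). \<forall>x. Poly_Mapping.keys x \<subseteq> Ob C \<longrightarrow>
    \<phi> (numerical_K0.num_cls K C x) = numerical_K0.num_cls K D x"
proof -
  interpret C: numerical_K0 K C by (rule C)
  interpret D: numerical_K0 K D by (rule D)
  define \<phi> where
    "\<phi> = (\<lambda>Z. D.num_cls (SOME x. Poly_Mapping.keys x \<subseteq> Ob C \<and> C.num_cls x = Z))"
  have \<phi>: "\<phi> (C.num_cls x) = D.num_cls x" if x: "Poly_Mapping.keys x \<subseteq> Ob C" for x
  proof -
    define y where "y = (SOME y. Poly_Mapping.keys y \<subseteq> Ob C \<and> C.num_cls y = C.num_cls x)"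
    have y: "Poly_Mapping.keys y \<subseteq> Ob C" "C.num_cls y = C.num_cls x"
      using someI[of "\<lambda>y. Poly_Mapping.keys y \<subseteq> Ob C \<and> C.num_cls y = C.num_cls x" x] x
      unfolding y_def by auto
    have "Poly_Mapping.keys (y - x) \<subseteq> Ob C"
      using x y by (auto dest: subsetD[OF keys_diff])
    then have "D.num_cls (y - x) = \<one>\<^bsub>K0_num K D\<^esub>"
      using ker C.num_cls_diff[OF y(1) x] y(2) by simp
    then have "D.num_cls y = D.num_cls x"
      using D.num_cls_diff[OF order_trans[OF y(1) Ob] order_trans[OF x Ob]] by simp
    then show ?thesis by (simp add: \<phi>_def y_def)
  qed
  have "\<phi> \<in> hom (K0_num K C) (K0_num K D)"
  proof (rule homI)
    fix Z assume "Z \<in> carrier (K0_num K C)"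
    then show "\<phi> Z \<in> carrier (K0_num K D)"
      using Ob by (auto simp: C.num_cls_surj D.num_cls_surj \<phi>)
  next
    fix Z Y assume "Z \<in> carrier (K0_num K C)" "Y \<in> carrier (K0_num K C)"
    then obtain x y where xy: "Poly_Mapping.keys x \<subseteq> Ob C" "Poly_Mapping.keys y \<subseteq> Ob C"
      and Z: "Z = C.num_cls x" and Y: "Y = C.num_cls y"
      by (auto simp: C.num_cls_surj)
    have "Poly_Mapping.keys (x + y) \<subseteq> Ob C"
      using xy by (auto dest!: subsetD[OF keys_add])
    moreover have "C.num_cls (x + y) = Z \<otimes>\<^bsub>K0_num K C\<^esub> Y"
      using hom_mult[OF C.num_cls_hom, of x y] xy by (simp add: Z Y)
    moreover have "D.num_cls (x + y) = D.num_cls x \<otimes>\<^bsub>K0_num K D\<^esub> D.num_cls y"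
      using hom_mult[OF D.num_cls_hom, of x y] xy Ob by auto
    ultimately show "\<phi> (Z \<otimes>\<^bsub>K0_num K C\<^esub> Y) = \<phi> Z \<otimes>\<^bsub>K0_num K D\<^esub> \<phi> Y"
      using \<phi>[of "x + y"] \<phi>[of x] \<phi>[of y] xy by (simp add: Z Y)
  qed
  with \<phi> show ?thesis by blast
qed

section \<open>Triangulated categories\<close>

context klinear_category
begin

lemma mor_ObD: "f \<in> mor C a b \<Longrightarrow> a \<in> Ob C" "f \<in> mor C a b \<Longrightarrow> b \<in> Ob C"
  using arr_ends by (auto simp: mor_def)

lemma mor_DomCod: "f \<in> mor C a b \<Longrightarrow> Dom C f = a" "f \<in> mor C a b \<Longrightarrow> Cod C f = b"
  by (auto simp: mor_def)

lemma abelian_group_mor: "\<lbrakk>a \<in> Ob C; b \<in> Ob C\<rbrakk> \<Longrightarrow> abelian_group (mor_space C a b)"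
  using mor_vectorspace by (simp add: vectorspace_def module_def)

definition neg :: "'m \<Rightarrow> 'm" where
  "neg f = \<ominus>\<^bsub>mor_space C (Dom C f) (Cod C f)\<^esub> f"

lemma azero_mor: "\<lbrakk>a \<in> Ob C; b \<in> Ob C\<rbrakk> \<Longrightarrow> azero C a b \<in> mor C a b"
  using abelian_monoid.zero_closed[OF abelian_group.axioms(1)[OF abelian_group_mor]]
  by (simp add: mor_space_def)

lemma aadd_mor: "\<lbrakk>f \<in> mor C a b; g \<in> mor C a b\<rbrakk> \<Longrightarrow> aadd C f g \<in> mor C a b"
  using abelian_monoid.a_closed[OF abelian_group.axioms(1)[OF abelian_group_mor], of a b f g]
  by (simp add: mor_space_def mor_ObD[of f a b])

lemma ascale_mor:
  assumes "k \<in> carrier K" "f \<in> mor C a b"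
  shows "ascale C k f \<in> mor C a b"
proof -
  have "module K (mor_space C a b)"
    using mor_vectorspace[OF mor_ObD[OF assms(2)]] by (simp add: vectorspace_def)
  from module.smult_closed[OF this assms(1), of f] assms(2) show ?thesis
    by (simp add: mor_space_def)
qed

lemma neg_mor: "f \<in> mor C a b \<Longrightarrow> neg f \<in> mor C a b"
  using abelian_group.a_inv_closed[OF abelian_group_mor, of a b f] mor_ObD[of f a b]
  by (simp add: neg_def mor_DomCod) (simp add: mor_space_def)

lemma add_azero: "f \<in> mor C a b \<Longrightarrow> aadd C f (azero C a b) = f"
  using abelian_monoid.r_zero[OF abelian_group.axioms(1)[OF abelian_group_mor], of a b f]
  by (simp add: mor_space_def mor_ObD[of f a b])

lemma add_neg: "f \<in> mor C a b \<Longrightarrow> aadd C f (neg f) = azero C a b"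
  using abelian_group.r_neg[OF abelian_group_mor, of a b f] mor_ObD[of f a b]
  by (simp add: neg_def mor_DomCod) (simp add: mor_space_def)

lemma aadd_comm: "\<lbrakk>f \<in> mor C a b; g \<in> mor C a b\<rbrakk> \<Longrightarrow> aadd C f g = aadd C g f"
  using abelian_monoid.a_comm[OF abelian_group.axioms(1)[OF abelian_group_mor], of a b f g]
  by (simp add: mor_space_def mor_ObD[of f a b])

lemma neg_unique:
  assumes f: "f \<in> mor C a b" and g: "g \<in> mor C a b" and eq: "aadd C f g = azero C a b"
  shows "g = neg f"
proof -
  have "g \<oplus>\<^bsub>mor_space C a b\<^esub> f = \<zero>\<^bsub>mor_space C a b\<^esub>"
    using eq aadd_comm[OF f g] by (simp add: mor_space_def)
  then have "\<ominus>\<^bsub>mor_space C a b\<^esub> f = g"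
    using abelian_group.minus_equality[OF abelian_group_mor[OF mor_ObD[OF f]]] f g
    by (simp add: mor_space_def)
  then show ?thesis by (simp add: neg_def mor_DomCod[OF f])
qed

text \<open>The common device for showing that composition and translation, being additive, preserve
  zero arrows.\<close>

lemma idempotent_zero:
  assumes "f \<in> mor C a b" "aadd C f f = f"
  shows "f = azero C a b"
  using group.r_cancel_one[OF abelian_group.a_group[OF abelian_group_mor[OF mor_ObD[OF assms(1)]]], of f f]
    assms by (simp add: mor_space_def)

lemma neg_neg:
  assumes "f \<in> mor C a b"
  shows "neg (neg f) = f"
  using neg_unique[OF neg_mor[OF assms] assms] add_neg[OF assms] aadd_comm[OF assms neg_mor[OF assms]]
  by simp

lemma eq_if_diff_zero:
  assumes "f \<in> mor C a b" "g \<in> mor C a b" "aadd C f (neg g) = azero C a b"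
  shows "f = g"
  using neg_unique[OF assms(1) neg_mor[OF assms(2)] assms(3)] neg_neg[OF assms(1)] neg_neg[OF assms(2)]
  by simp

lemma neg_azero:
  assumes "a \<in> Ob C" "b \<in> Ob C"
  shows "neg (azero C a b) = azero C a b"
  using neg_unique[of "azero C a b" a b "azero C a b"] azero_mor[OF assms]
    add_azero[of "azero C a b" a b] by simp

lemma cmp_azero_right:
  assumes "g \<in> mor C b c" "a \<in> Ob C"
  shows "g \<star> azero C a b = azero C a c"
proof -
  have z: "azero C a b \<in> mor C a b" using assms mor_ObD azero_mor by blast
  have "g \<star> azero C a b = g \<star> aadd C (azero C a b) (azero C a b)"
    using add_azero[OF z] by simp
  also have "\<dots> = aadd C (g \<star> azero C a b) (g \<star> azero C a b)"
    by (rule cmp_add_right[OF z z assms(1)])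
  finally show ?thesis
    using idempotent_zero cmp_mor[OF z assms(1)] by simp
qed

lemma cmp_azero_left:
  assumes "f \<in> mor C a b" "c \<in> Ob C"
  shows "azero C b c \<star> f = azero C a c"
proof -
  have z: "azero C b c \<in> mor C b c" using assms mor_ObD azero_mor by blast
  have "azero C b c \<star> f = aadd C (azero C b c) (azero C b c) \<star> f"
    using add_azero[OF z] by simp
  also have "\<dots> = aadd C (azero C b c \<star> f) (azero C b c \<star> f)"
    by (rule cmp_add_left[OF assms(1) z z])
  finally show ?thesis
    using idempotent_zero cmp_mor[OF assms(1) z] by simp
qed

lemma cmp_neg_right:
  assumes "f \<in> mor C a b" "g \<in> mor C b c"
  shows "g \<star> neg f = neg (g \<star> f)"
proof (rule neg_unique)
  show "g \<star> f \<in> mor C a c" "g \<star> neg f \<in> mor C a c"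
    using assms by (auto intro: cmp_mor neg_mor)
  show "aadd C (g \<star> f) (g \<star> neg f) = azero C a c"
    using cmp_add_right[OF assms(1) neg_mor[OF assms(1)] assms(2)]
    by (simp add: add_neg[OF assms(1)] cmp_azero_right[OF assms(2)] mor_ObD[OF assms(1)])
qed

lemma cmp_neg_left:
  assumes "f \<in> mor C a b" "g \<in> mor C b c"
  shows "neg g \<star> f = neg (g \<star> f)"
proof (rule neg_unique)
  show "g \<star> f \<in> mor C a c" "neg g \<star> f \<in> mor C a c"
    using assms by (auto intro: cmp_mor neg_mor)
  show "aadd C (g \<star> f) (neg g \<star> f) = azero C a c"
    using cmp_add_left[OF assms(1,2) neg_mor[OF assms(2)]]
    by (simp add: add_neg[OF assms(2)] cmp_azero_left[OF assms(1)] mor_ObD[OF assms(2)])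
qed

lemma is_iso_idn: "a \<in> Ob C \<Longrightarrow> is_iso C (idn C a)"
  using idn_mor[of a] cmp_idn_left[of "idn C a" a a]
  unfolding is_iso_def by (auto simp: mor_def)

lemma is_iso_neg_idn:
  assumes "a \<in> Ob C"
  shows "is_iso C (neg (idn C a))"
proof -
  have i: "idn C a \<in> mor C a a" by (rule idn_mor[OF assms])
  have n: "neg (idn C a) \<in> mor C a a" by (rule neg_mor[OF i])
  have "neg (idn C a) \<star> neg (idn C a) = idn C a"
    using cmp_neg_left[OF n i] cmp_idn_left[OF n] neg_neg[OF i] by simp
  then show ?thesis
    using n unfolding is_iso_def by (auto simp: mor_def intro!: bexI[of _ "neg (idn C a)"])
qed

end

section \<open>Rotation, lifting and extension along distinguished triangles\<close>

context klinear_triangulated_category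
begin

lemma sho_Ob: "a \<in> Ob C \<Longrightarrow> sho C n a \<in> Ob C"
  using shift_functor[of n] by (simp add: is_functor_def)

lemma sha_mor: "f \<in> mor C a b \<Longrightarrow> sha C n f \<in> mor C (sho C n a) (sho C n b)"
  using shift_functor[of n] mor_ObD[of f a b] by (simp add: is_functor_def)

lemma sha_idn: "a \<in> Ob C \<Longrightarrow> sha C n (idn C a) = idn C (sho C n a)"
  using shift_functor[of n] by (simp add: is_functor_def)

lemma sha_cmp: "\<lbrakk>f \<in> mor C a b; g \<in> mor C b c\<rbrakk> \<Longrightarrow> sha C n (g \<star> f) = sha C n g \<star> sha C n f"
  using shift_functor[of n] by (simp add: is_functor_def mor_def)

lemma sha_azero:
  assumes "a \<in> Ob C" "b \<in> Ob C"
  shows "sha C n (azero C a b) = azero C (sho C n a) (sho C n b)"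
proof -
  have z: "azero C a b \<in> mor C a b" by (rule azero_mor[OF assms])
  have "aadd C (sha C n (azero C a b)) (sha C n (azero C a b)) = sha C n (azero C a b)"
    using shift_add[OF z z] add_azero[OF z] by simp
  then show ?thesis by (rule idempotent_zero[OF sha_mor[OF z]])
qed

lemma sha_neg:
  assumes "f \<in> mor C a b"
  shows "sha C n (neg f) = neg (sha C n f)"
proof (rule neg_unique)
  show "sha C n f \<in> mor C (sho C n a) (sho C n b)" "sha C n (neg f) \<in> mor C (sho C n a) (sho C n b)"
    using assms by (auto intro: sha_mor neg_mor)
  show "aadd C (sha C n f) (sha C n (neg f)) = azero C (sho C n a) (sho C n b)"
    using shift_add[OF assms neg_mor[OF assms]] add_neg[OF assms] sha_azero mor_ObD[OF assms] by simp
qed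

lemma sha_minus_sha: "f \<in> mor C a b \<Longrightarrow> sha C (- n) (sha C n f) = f"
  using sha_sha[of f "- n" n] sha_0[of f] by (simp add: mor_def)

lemma sha_sha_minus: "f \<in> mor C a b \<Longrightarrow> sha C n (sha C (- n) f) = f"
  using sha_sha[of f n "- n"] sha_0[of f] by (simp add: mor_def)

lemma sho_minus_sho: "a \<in> Ob C \<Longrightarrow> sho C (- n) (sho C n a) = a"
  using sho_sho[of a "- n" n] sho_0[of a] by simp

lemma sho_sho_minus: "a \<in> Ob C \<Longrightarrow> sho C n (sho C (- n) a) = a"
  using sho_sho[of a n "- n"] sho_0[of a] by simp

lemma sha_eq_azeroD:
  assumes "f \<in> mor C a b" "sha C n f = azero C (sho C n a) (sho C n b)"
  shows "f = azero C a b"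
proof -
  have "f = sha C (- n) (sha C n f)" using sha_minus_sha[OF assms(1)] by simp
  also have "\<dots> = azero C a b"
    using assms mor_ObD[OF assms(1)] by (simp add: sha_azero sho_Ob sho_minus_sho)
  finally show ?thesis .
qed

lemma zero_object_sho: "zero_object C z \<Longrightarrow> zero_object C (sho C n z)"
  unfolding zero_object_def using sho_Ob sha_idn[of z n] sha_azero[of z z n] by auto

lemma dist_mors:
  assumes "(f, g, h) \<in> Dist C"
  shows "f \<in> mor C (Dom C f) (Cod C f)" "g \<in> mor C (Cod C f) (Cod C g)"
    "h \<in> mor C (Cod C g) (sho C 1 (Dom C f))"
  using dist_triangle[OF assms] by (auto simp: mor_def)

lemma rotate:
  assumes "(f, g, h) \<in> Dist C"
  shows "(g, h, neg (sha C 1 f)) \<in> Dist C"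
  using TR2[OF dist_triangle[OF assms]] assms mor_DomCod[OF sha_mor[OF dist_mors(1)[OF assms], of 1]]
  by (simp add: neg_def)

lemma rotate_back:
  assumes "f \<in> mor C a b" "g \<in> mor C b c" "h \<in> mor C c (sho C 1 a)"
    and "(g, h, neg (sha C 1 f)) \<in> Dist C"
  shows "(f, g, h) \<in> Dist C"
proof -
  have "triangle C (f, g, h)" using assms by (auto simp: mor_def)
  from TR2[OF this] assms(4) mor_DomCod[OF assms(1)] mor_DomCod[OF sha_mor[OF assms(1), of 1]]
  show ?thesis by (simp add: neg_def)
qed

lemma rotate_back_ex:
  assumes "(f, g, h) \<in> Dist C" "f \<in> mor C a b"
  shows "\<exists>k \<in> mor C (sho C (- 1) (Cod C g)) a. (k, f, g) \<in> Dist C"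
proof -
  note [simp] = mor_DomCod[OF assms(2)]
  have a: "a \<in> Ob C" using assms(2) by (rule mor_ObD)
  have g: "g \<in> mor C b (Cod C g)" and h: "h \<in> mor C (Cod C g) (sho C 1 a)"
    using dist_mors[OF assms(1)] by simp_all
  \<comment> \<open>The sign is chosen so that the one introduced by rotation cancels and rotating
    \<open>(k, f, g)\<close> forward gives back \<open>h\<close>.\<close>
  define k where "k = neg (sha C (- 1) h)"
  have h': "sha C (- 1) h \<in> mor C (sho C (- 1) (Cod C g)) a"
    using sha_mor[OF h, of "- 1"] sho_minus_sho[OF a, of 1] by simp
  then have k: "k \<in> mor C (sho C (- 1) (Cod C g)) a"
    unfolding k_def by (rule neg_mor)
  have "sha C 1 k = neg h"
    unfolding k_def sha_neg[OF h'] using sha_sha_minus[OF h, of 1] by simp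
  then have "neg (sha C 1 k) = h" using neg_neg[OF h] by simp
  then have "(k, f, g) \<in> Dist C"
    using rotate_back[OF k assms(2)] g assms(1) sho_sho_minus[OF mor_ObD(1)[OF h], of 1] by simp
  with k show ?thesis by blast
qed

lemma fiber_ex:
  assumes "k \<in> mor C z x"
  shows "\<exists>w. \<exists>t \<in> mor C w z. \<exists>g. (t, k, g) \<in> Dist C"
proof -
  obtain g h where "(k, g, h) \<in> Dist C" using TR1_cone[of k] assms by (auto simp: mor_def)
  from rotate_back_ex[OF this assms] show ?thesis by blast
qed

text \<open>Mapping the triangle of the identity of \<open>a\<close> to the given one by the
  identity and \<open>f\<close>, TR3 factors \<open>g \<star> f\<close> through a zero
  object.\<close>

lemma dist_cmp_azero:
  assumes d: "(f, g, h) \<in> Dist C"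
  shows "g \<star> f = azero C (Dom C f) (Cod C g)"
proof -
  let ?a = "Dom C f"
  note m = dist_mors[OF d]
  have a: "?a \<in> Ob C" using m(1) mor_ObD by blast
  obtain z where z: "zero_object C z" using zero_object_exists ..
  then have zOb: "z \<in> Ob C" by (simp add: zero_object_def)
  have i: "idn C ?a \<in> mor C ?a ?a" by (rule idn_mor[OF a])
  have za: "azero C ?a z \<in> mor C ?a z" by (rule azero_mor[OF a zOb])
  obtain w where "triangle_map C (idn C ?a, azero C ?a z, azero C z (sho C 1 ?a)) (f, g, h) (idn C ?a, f, w)"
    using TR3[OF TR1_id[OF a z] d, of "idn C ?a" f] mor_DomCod[OF i] i m(1) by auto
  then have w: "w \<in> mor C z (Cod C g)" "w \<star> azero C ?a z = g \<star> f"
    using mor_DomCod[OF za] by auto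
  then show ?thesis using cmp_azero_right[OF w(1) a] by simp
qed

text \<open>TR3 produces only third components, so the triangle of the identity of \<open>x\<close>
  and the given one are both rotated once. The third component \<open>w\<close> is then the sought
  lift, shifted by one, and the two signs from rotation cancel.\<close>

lemma dist_factor_through:
  assumes d: "(f, g, h) \<in> Dist C" and u: "u \<in> mor C x (Cod C f)"
    and 0: "g \<star> u = azero C x (Cod C g)"
  shows "\<exists>v \<in> mor C x (Dom C f). f \<star> v = u"
proof -
  let ?a = "Dom C f" and ?b = "Cod C f" and ?c = "Cod C g"
  note m = dist_mors[OF d]
  have x: "x \<in> Ob C" and c: "?c \<in> Ob C" and a: "?a \<in> Ob C"
    using u m mor_ObD by blast+
  obtain z where z: "zero_object C z" using zero_object_exists ..
  then have zOb: "z \<in> Ob C" by (simp add: zero_object_def)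
  have i: "idn C x \<in> mor C x x" by (rule idn_mor[OF x])
  have xz: "azero C x z \<in> mor C x z" and zx: "azero C z (sho C 1 x) \<in> mor C z (sho C 1 x)"
    and zc: "azero C z ?c \<in> mor C z ?c"
    by (intro azero_mor x zOb c sho_Ob)+
  have "azero C z ?c \<star> azero C x z = g \<star> u"
    using 0 cmp_azero_right[OF zc x] by simp
  then obtain w where "triangle_map C (azero C x z, azero C z (sho C 1 x), neg (sha C 1 (idn C x)))
      (g, h, neg (sha C 1 f)) (u, azero C z ?c, w)"
    using TR3[OF rotate[OF TR1_id[OF x z]] rotate[OF d], of u "azero C z ?c"] u zc
      mor_DomCod[OF xz] mor_DomCod[OF m(2)] by auto
  then have w: "w \<in> mor C (sho C 1 x) (sho C 1 ?a)"
    and eq: "sha C 1 u \<star> neg (sha C 1 (idn C x)) = neg (sha C 1 f) \<star> w"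
    using mor_DomCod[OF zx] mor_DomCod[OF m(3)] by auto
  define v where "v = sha C (- 1) w"
  have v: "v \<in> mor C x ?a"
    using sha_mor[OF w, of "- 1"] sho_minus_sho[OF x, of 1] sho_minus_sho[OF a, of 1] by (simp add: v_def)
  have fv: "f \<star> v \<in> mor C x ?b" by (rule cmp_mor[OF v m(1)])
  have "neg (sha C 1 u) = neg (sha C 1 f \<star> w)"
    using eq cmp_neg_right[OF sha_mor[OF i] sha_mor[OF u], of 1] cmp_neg_left[OF w sha_mor[OF m(1)]]
      sha_cmp[OF i u, of 1] cmp_idn_right[OF u] by simp
  then have "sha C 1 u = sha C 1 f \<star> w"
    using neg_neg[OF sha_mor[OF u]] neg_neg[OF cmp_mor[OF w sha_mor[OF m(1)]]] by metis
  also have "\<dots> = sha C 1 (f \<star> v)"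
    using sha_cmp[OF v m(1), of 1] sha_sha_minus[OF w, of 1] by (simp add: v_def)
  finally have "sha C (- 1) (sha C 1 (f \<star> v)) = sha C (- 1) (sha C 1 u)" by simp
  then have "f \<star> v = u" using sha_minus_sha[OF fv, of 1] sha_minus_sha[OF u, of 1] by simp
  with v show ?thesis by blast
qed

text \<open>Dual to lifting: \<open>v\<close> is completed to a map into the triangle
  \<open>z \<rightarrow> x \<rightarrow> x \<rightarrow> z[1]\<close> with \<open>z\<close> a zero
  object, and the third component is the extension.\<close>

lemma dist_extend_along:
  assumes d: "(f, g, h) \<in> Dist C" and v: "v \<in> mor C (Cod C f) x"
    and 0: "v \<star> f = azero C (Dom C f) x"
  shows "\<exists>w \<in> mor C (Cod C g) x. w \<star> g = v"
proof -
  let ?a = "Dom C f"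
  note m = dist_mors[OF d]
  have x: "x \<in> Ob C" and a: "?a \<in> Ob C"
    using v m mor_ObD by blast+
  obtain z where z: "zero_object C z" using zero_object_exists ..
  then have zOb: "z \<in> Ob C" and z1: "zero_object C (sho C 1 z)" and z1Ob: "sho C 1 z \<in> Ob C"
    using zero_object_sho by (auto simp: zero_object_def)
  have i: "idn C x \<in> mor C x x" by (rule idn_mor[OF x])
  have zx: "azero C z x \<in> mor C z x" and xz: "azero C x (sho C 1 z) \<in> mor C x (sho C 1 z)"
    and az: "azero C ?a z \<in> mor C ?a z"
    by (intro azero_mor x zOb a z1Ob)+
  \<comment> \<open>The target triangle is the back rotation of the identity triangle of
    \<open>x\<close>, whose zero object must therefore be \<open>sho C 1 z\<close>.\<close>
  have "neg (sha C 1 (azero C z x)) = azero C (sho C 1 z) (sho C 1 x)"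
    using sha_azero[OF zOb x, of 1] neg_azero[OF z1Ob sho_Ob[OF x]] by simp
  then have "(azero C z x, idn C x, azero C x (sho C 1 z)) \<in> Dist C"
    using rotate_back[OF zx i xz] TR1_id[OF x z1] by simp
  moreover have "v \<star> f = azero C z x \<star> azero C ?a z"
    using 0 cmp_azero_right[OF zx a] by simp
  ultimately obtain w where
    "triangle_map C (f, g, h) (azero C z x, idn C x, azero C x (sho C 1 z)) (azero C ?a z, v, w)"
    using TR3[OF d, of "azero C z x" "idn C x" _ "azero C ?a z" v] az v mor_DomCod[OF zx] by auto
  then have "w \<in> mor C (Cod C g) x" "w \<star> g = v"
    using mor_DomCod[OF i] cmp_idn_left[OF v] by auto
  then show ?thesis by blast
qed

text \<open>The isomorphism is the identity on the outer objects and minus the identity on the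
  middle one.\<close>

lemma dist_neg_neg:
  assumes d: "(f, g, h) \<in> Dist C"
  shows "(neg f, neg g, h) \<in> Dist C"
proof (rule TR1_iso[OF d])
  let ?a = "Dom C f" and ?b = "Cod C f" and ?c = "Cod C g"
  note m = dist_mors[OF d]
  note n = neg_mor[OF m(1)] neg_mor[OF m(2)]
  have a: "?a \<in> Ob C" and b: "?b \<in> Ob C" and c: "?c \<in> Ob C"
    using m mor_ObD by blast+
  note i = idn_mor[OF a] idn_mor[OF b] idn_mor[OF c]
  have "triangle_map C (f, g, h) (neg f, neg g, h) (idn C ?a, neg (idn C ?b), idn C ?c)"
    using i neg_mor[OF i(2)] mor_DomCod[OF n(1)] mor_DomCod[OF n(2)] mor_DomCod[OF m(3)]
      cmp_neg_left[OF m(1) i(2)] cmp_idn_left[OF m(1)] cmp_idn_right[OF n(1)]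
      cmp_idn_left[OF m(2)] cmp_neg_left[OF neg_mor[OF i(2)] m(2)] cmp_neg_right[OF i(2) m(2)]
      cmp_idn_right[OF m(2)] neg_neg[OF m(2)] sha_idn[OF a, of 1] cmp_idn_left[OF m(3)]
      cmp_idn_right[OF m(3)]
    by simp
  moreover have "triangle C (neg f, neg g, h)"
    using n m(3) by (auto simp: mor_def)
  ultimately show "triangle_iso C (f, g, h) (neg f, neg g, h)"
    unfolding triangle_iso_def
    using dist_triangle[OF d] is_iso_idn[OF a] is_iso_neg_idn[OF b] is_iso_idn[OF c] by blast
qed

text \<open>Rotating three times shifts a triangle and negates all three arrows; two of the signs cancel.\<close>

lemma dist_shift:
  assumes "f \<in> mor C a b" "g \<in> mor C b c" "h \<in> mor C c (sho C 1 a)"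
  shows "(f, g, h) \<in> Dist C \<longleftrightarrow> (sha C 1 f, sha C 1 g, neg (sha C 1 h)) \<in> Dist C"
proof
  assume "(f, g, h) \<in> Dist C"
  then have "(neg (sha C 1 f), neg (sha C 1 g), neg (sha C 1 h)) \<in> Dist C"
    by (intro rotate)
  from dist_neg_neg[OF this] show "(sha C 1 f, sha C 1 g, neg (sha C 1 h)) \<in> Dist C"
    using neg_neg[OF sha_mor[OF assms(1)]] neg_neg[OF sha_mor[OF assms(2)]] by simp
next
  assume "(sha C 1 f, sha C 1 g, neg (sha C 1 h)) \<in> Dist C"
  from dist_neg_neg[OF this]
  have "(neg (sha C 1 f), neg (sha C 1 g), neg (sha C 1 h)) \<in> Dist C" .
  then have "(h, neg (sha C 1 f), neg (sha C 1 g)) \<in> Dist C"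
    by (rule rotate_back[OF assms(3) neg_mor[OF sha_mor[OF assms(1)]] neg_mor[OF sha_mor[OF assms(2)]]])
  then have "(g, h, neg (sha C 1 f)) \<in> Dist C"
    by (rule rotate_back[OF assms(2) assms(3) neg_mor[OF sha_mor[OF assms(1)]]])
  then show "(f, g, h) \<in> Dist C"
    by (rule rotate_back[OF assms])
qed

end

section \<open>Hom spaces of the Verdier quotient\<close>

locale triangulated_subcategory = klinear_triangulated_category K C
  for K :: "('k, 'r) ring_scheme" and C :: "('o, 'm, 'k) tricat" (structure) +
  fixes S :: "'o set"
  assumes strict: "strictly_full_triangulated_subcategory C S"
begin

lemma S_Ob: "a \<in> S \<Longrightarrow> a \<in> Ob C"
  using strict by (auto simp: strictly_full_triangulated_subcategory_def)

lemma S_zero: "\<exists>z \<in> S. zero_object C z"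
  using strict by (auto simp: strictly_full_triangulated_subcategory_def)

lemma S_sho: "a \<in> S \<Longrightarrow> sho C n a \<in> S"
  using strict by (auto simp: strictly_full_triangulated_subcategory_def)

lemma S_cone: "\<lbrakk>(f, g, h) \<in> Dist C; Dom C f \<in> S; Cod C f \<in> S\<rbrakk> \<Longrightarrow> Cod C g \<in> S"
  using strict unfolding strictly_full_triangulated_subcategory_def by blast

text \<open>Two rotations exhibit the shifted middle object as the cone of \<open>h\<close>, whose
  ends lie in \<open>S\<close>.\<close>

lemma S_middle:
  assumes d: "(f, g, h) \<in> Dist C" and "Dom C f \<in> S" "Cod C g \<in> S"
  shows "Cod C f \<in> S"
proof -
  note m = dist_mors[OF d]
  have "Cod C (neg (sha C 1 f)) \<in> S"
    using S_cone[OF rotate[OF rotate[OF d]]] mor_DomCod[OF m(3)] assms S_sho by simp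
  then have "sho C 1 (Cod C f) \<in> S"
    using mor_DomCod[OF neg_mor[OF sha_mor[OF m(1)]], of 1] by simp
  from S_sho[OF this, of "- 1"] show ?thesis
    using sho_minus_sho[OF mor_ObD(2)[OF m(1)], of 1] by simp
qed

section \<open>Arrows with cone in \<open>S\<close> as a multiplicative system\<close>

lemma cone_in_mor: "s \<in> cone_in C S \<Longrightarrow> s \<in> mor C (Dom C s) (Cod C s)"
  using dist_mors(1) unfolding cone_in_def by blast

lemma idn_cone_in:
  assumes "a \<in> Ob C"
  shows "idn C a \<in> cone_in C S"
proof -
  obtain z where z: "z \<in> S" "zero_object C z" using S_zero by blast
  have "Cod C (azero C a z) = z"
    by (rule mor_DomCod[OF azero_mor[OF assms S_Ob[OF z(1)]]])
  with TR1_id[OF assms z(2)] z(1) show ?thesis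
    unfolding cone_in_def by auto
qed

text \<open>The octahedral axiom places the cone of the composite in the middle of a triangle
  between the cones of \<open>f\<close> and \<open>g\<close>.\<close>

lemma cone_in_cmp:
  assumes f: "f \<in> cone_in C S" "f \<in> mor C x y" and g: "g \<in> cone_in C S" "g \<in> mor C y z"
  shows "g \<star> f \<in> cone_in C S"
proof -
  obtain p1 d1 where 1: "(f, p1, d1) \<in> Dist C" "Cod C p1 \<in> S"
    using f by (auto simp: cone_in_def)
  obtain p3 d3 where 3: "(g, p3, d3) \<in> Dist C" "Cod C p3 \<in> S"
    using g by (auto simp: cone_in_def)
  have gf: "g \<star> f \<in> mor C x z" by (rule cmp_mor[OF f(2) g(2)])
  then obtain p2 d2 where 2: "(g \<star> f, p2, d2) \<in> Dist C"
    using TR1_cone[of "g \<star> f"] by (auto simp: mor_def)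
  obtain a b where ab: "(a, b, sha C 1 p1 \<star> d3) \<in> Dist C"
    and a: "triangle_map C (f, p1, d1) (g \<star> f, p2, d2) (idn C x, g, a)"
    and b: "triangle_map C (g \<star> f, p2, d2) (g, p3, d3) (f, idn C z, b)"
    using TR4[OF f(2) g(2) 1(1) 2 3(1)] by blast
  have "a \<in> mor C (Cod C p1) (Cod C p2)" "b \<in> mor C (Cod C p2) (Cod C p3)"
    using a b by auto
  then have "Cod C p2 \<in> S"
    using S_middle[OF ab] 1(2) 3(2) by (simp add: mor_DomCod)
  with 2 show ?thesis unfolding cone_in_def by blast
qed

text \<open>An equivalence, so that the integer induction for general shifts can also
  descend.\<close>

lemma cone_in_sha_1:
  assumes "s \<in> mor C a b"
  shows "sha C 1 s \<in> cone_in C S \<longleftrightarrow> s \<in> cone_in C S"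
proof
  assume "s \<in> cone_in C S"
  then obtain g h where d: "(s, g, h) \<in> Dist C" "Cod C g \<in> S" by (auto simp: cone_in_def)
  note m = dist_mors[OF d(1)]
  from dist_shift[OF m] d(1) have "(sha C 1 s, sha C 1 g, neg (sha C 1 h)) \<in> Dist C" by simp
  moreover have "Cod C (sha C 1 g) \<in> S"
    using S_sho[OF d(2), of 1] mor_DomCod[OF sha_mor[OF m(2)], of 1] by simp
  ultimately show "sha C 1 s \<in> cone_in C S" unfolding cone_in_def by blast
next
  assume "sha C 1 s \<in> cone_in C S"
  then obtain g h where d: "(sha C 1 s, g, h) \<in> Dist C" "Cod C g \<in> S" by (auto simp: cone_in_def)
  define c where "c = sho C (- 1) (Cod C g)"
  define g' where "g' = sha C (- 1) g"
  \<comment> \<open>The sign compensates for the one that \<open>dist_shift\<close> puts on the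
    third arrow.\<close>
  define h' where "h' = neg (sha C (- 1) h)"
  have ab: "a \<in> Ob C" "b \<in> Ob C" using assms mor_ObD by blast+
  have g: "g \<in> mor C (sho C 1 b) (Cod C g)"
    and h: "h \<in> mor C (Cod C g) (sho C 1 (sho C 1 a))"
    using dist_mors(2,3)[OF d(1)] mor_DomCod[OF sha_mor[OF assms], of 1] by simp_all
  have g': "g' \<in> mor C b c"
    using sha_mor[OF g, of "- 1"] sho_minus_sho[OF ab(2), of 1] by (simp add: g'_def c_def)
  have h0: "sha C (- 1) h \<in> mor C c (sho C 1 a)"
    using sha_mor[OF h, of "- 1"] sho_minus_sho[OF sho_Ob[OF ab(1), of 1], of 1] by (simp add: c_def)
  then have h': "h' \<in> mor C c (sho C 1 a)"
    unfolding h'_def by (rule neg_mor)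
  have "sha C 1 g' = g" unfolding g'_def using sha_sha_minus[OF g, of 1] by simp
  moreover have "neg (sha C 1 h') = h"
    unfolding h'_def sha_neg[OF h0] using sha_sha_minus[OF h, of 1] neg_neg[OF h] by simp
  ultimately have "(s, g', h') \<in> Dist C"
    using dist_shift[OF assms g' h'] d(1) by simp
  moreover have "Cod C g' \<in> S"
    using S_sho[OF d(2), of "- 1"] mor_DomCod[OF g'] by (simp add: c_def)
  ultimately show "s \<in> cone_in C S" unfolding cone_in_def by blast
qed

lemma cone_in_sha:
  assumes "s \<in> cone_in C S"
  shows "sha C n s \<in> cone_in C S"
proof (induction n rule: int_induct[of _ 0])
  case base
  then show ?case using assms cone_in_mor[OF assms] sha_0[of s] by (simp add: mor_def)
next
  case (step1 i)
  have "sha C (i + 1) s = sha C 1 (sha C i s)"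
    using sha_sha[of s 1 i] cone_in_mor[OF assms] by (simp add: mor_def add.commute)
  with step1 cone_in_sha_1[OF sha_mor[OF cone_in_mor[OF assms], of i]] show ?case by simp
next
  case (step2 i)
  have "sha C i s = sha C 1 (sha C (i - 1) s)"
    using sha_sha[of s 1 "i - 1"] cone_in_mor[OF assms] by (simp add: mor_def)
  with step2 cone_in_sha_1[OF sha_mor[OF cone_in_mor[OF assms], of "i - 1"]] show ?case by simp
qed

text \<open>With \<open>g\<close> the arrow from \<open>a\<close> to the cone of \<open>s\<close>,
  take for \<open>u'\<close> the fibre of \<open>g \<star> s'\<close>: its cone is that of
  \<open>s\<close>, and \<open>s' \<star> u'\<close> is killed by \<open>g\<close>, hence factors
  through \<open>s\<close>.\<close>

lemma ore_square:
  assumes s: "s \<in> cone_in C S" "s \<in> mor C z a" and s': "s' \<in> mor C z' a"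
  shows "\<exists>w. \<exists>u \<in> mor C w z. \<exists>u' \<in> mor C w z'. s \<star> u = s' \<star> u' \<and> u' \<in> cone_in C S"
proof -
  obtain g h where d: "(s, g, h) \<in> Dist C" "Cod C g \<in> S" using s by (auto simp: cone_in_def)
  have g: "g \<in> mor C a (Cod C g)" using dist_mors(2)[OF d(1)] mor_DomCod[OF s(2)] by simp
  have gs': "g \<star> s' \<in> mor C z' (Cod C g)" by (rule cmp_mor[OF s' g])
  obtain w u' k where u': "u' \<in> mor C w z'" and d': "(u', g \<star> s', k) \<in> Dist C"
    using fiber_ex[OF gs'] by blast
  have "u' \<in> cone_in C S"
    using d' d(2) mor_DomCod[OF gs'] unfolding cone_in_def by auto
  have su: "s' \<star> u' \<in> mor C w a" by (rule cmp_mor[OF u' s'])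
  have "g \<star> (s' \<star> u') = azero C w (Cod C g)"
    using dist_cmp_azero[OF d'] mor_DomCod[OF u'] mor_DomCod[OF gs'] cmp_assoc[OF u' s' g] by simp
  then obtain u where "u \<in> mor C w z" "s \<star> u = s' \<star> u'"
    using dist_factor_through[OF d(1)] su mor_DomCod[OF s(2)] by auto
  with u' \<open>u' \<in> cone_in C S\<close> show ?thesis by blast
qed

text \<open>As \<open>p\<close> kills \<open>d\<close>, the arrow \<open>d\<close> factors as
  \<open>k \<star> e\<close> through the fibre of \<open>p\<close>, a shifted object of
  \<open>S\<close>. The fibre \<open>t\<close> of \<open>e\<close> then has its cone in
  \<open>S\<close> and kills \<open>d\<close>.\<close>

lemma cone_in_annihilator:
  assumes p: "p \<in> cone_in C S" "p \<in> mor C b y" and d: "d \<in> mor C w b" "p \<star> d = azero C w y"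
  shows "\<exists>w'. \<exists>t \<in> mor C w' w. t \<in> cone_in C S \<and> d \<star> t = azero C w' b"
proof -
  obtain g h where gh: "(p, g, h) \<in> Dist C" "Cod C g \<in> S" using p by (auto simp: cone_in_def)
  obtain k where k: "k \<in> mor C (sho C (- 1) (Cod C g)) b" "(k, p, g) \<in> Dist C"
    using rotate_back_ex[OF gh(1) p(2)] by blast
  then obtain e where e: "e \<in> mor C w (sho C (- 1) (Cod C g))" "k \<star> e = d"
    using dist_factor_through[OF k(2), of d w] d mor_DomCod[OF k(1)] mor_DomCod[OF p(2)] by auto
  obtain w' t l where t: "t \<in> mor C w' w" "(t, e, l) \<in> Dist C"
    using fiber_ex[OF e(1)] by blast
  have "t \<in> cone_in C S"
    using t(2) S_sho[OF gh(2), of "- 1"] mor_DomCod[OF e(1)] unfolding cone_in_def by auto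
  moreover have "d \<star> t = azero C w' b"
    using dist_cmp_azero[OF t(2)] mor_DomCod[OF t(1)] mor_DomCod[OF e(1)]
      cmp_assoc[OF t(1) e(1) k(1)] cmp_azero_right[OF k(1) mor_ObD(1)[OF t(1)]] e(2) by simp
  ultimately show ?thesis using t(1) by blast
qed

text \<open>The right orthogonal of \<open>S\<close>. Vanishing in degree 0 covers all degrees
  because \<open>S\<close> is stable under translation.\<close>

definition perp :: "'o set" where
  "perp = {x \<in> Ob C. \<forall>a \<in> S. \<forall>f \<in> mor C a x. f = azero C a x}"

lemma perp_sho:
  assumes "x \<in> perp"
  shows "sho C n x \<in> perp"
proof -
  have x: "x \<in> Ob C" using assms by (simp add: perp_def)
  have "f = azero C a (sho C n x)" if a: "a \<in> S" and f: "f \<in> mor C a (sho C n x)" for a f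
  proof -
    have aOb: "a \<in> Ob C" using a by (rule S_Ob)
    have f': "sha C (- n) f \<in> mor C (sho C (- n) a) x"
      using sha_mor[OF f, of "- n"] sho_minus_sho[OF x] by simp
    then have "sha C (- n) f = azero C (sho C (- n) a) x"
      using assms S_sho[OF a] by (simp add: perp_def)
    then have "sha C n (sha C (- n) f) = azero C a (sho C n x)"
      using sha_azero[OF sho_Ob[OF aOb] x] sho_sho_minus[OF aOb] by simp
    then show ?thesis using sha_sha_minus[OF f] by simp
  qed
  then show ?thesis using sho_Ob[OF x] by (simp add: perp_def)
qed

text \<open>The difference of \<open>g\<close> and \<open>g'\<close> kills \<open>s\<close>, so it
  factors through the cone of \<open>s\<close>, and there is no nonzero arrow from that cone to
  \<open>x\<close>.\<close>

lemma perp_cancel: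
  assumes s: "s \<in> cone_in C S" "s \<in> mor C z a" and x: "x \<in> perp"
    and g: "g \<in> mor C a x" "g' \<in> mor C a x" and eq: "g \<star> s = g' \<star> s"
  shows "g = g'"
proof -
  obtain k h where d: "(s, k, h) \<in> Dist C" "Cod C k \<in> S" using s by (auto simp: cone_in_def)
  have k: "k \<in> mor C a (Cod C k)" using dist_mors(2)[OF d(1)] mor_DomCod[OF s(2)] by simp
  define e where "e = aadd C g (neg g')"
  have e: "e \<in> mor C a x" unfolding e_def by (intro aadd_mor g neg_mor)
  have gs: "g' \<star> s \<in> mor C z x" by (rule cmp_mor[OF s(2) g(2)])
  have "e \<star> s = aadd C (g \<star> s) (neg (g' \<star> s))"
    unfolding e_def using cmp_add_left[OF s(2) g(1) neg_mor[OF g(2)]] cmp_neg_left[OF s(2) g(2)] by simp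
  then have "e \<star> s = azero C z x" using add_neg[OF gs] eq by simp
  then obtain v where v: "v \<in> mor C (Cod C k) x" "v \<star> k = e"
    using dist_extend_along[OF d(1), of e x] e mor_DomCod[OF s(2)] by auto
  then have "v = azero C (Cod C k) x" using x d(2) by (simp add: perp_def)
  then have "e = azero C a x"
    using v cmp_azero_left[OF k] mor_ObD(2)[OF e] by simp
  then show ?thesis unfolding e_def by (rule eq_if_diff_zero[OF g])
qed

text \<open>The obstruction is the composite of \<open>f\<close> with the fibre of \<open>s\<close>,
  an arrow from a shifted object of \<open>S\<close> to \<open>x\<close>.\<close>

lemma perp_extend:
  assumes s: "s \<in> cone_in C S" "s \<in> mor C z a" and x: "x \<in> perp" and f: "f \<in> mor C z x"
  shows "\<exists>g \<in> mor C a x. g \<star> s = f"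
proof -
  obtain g h where d: "(s, g, h) \<in> Dist C" "Cod C g \<in> S" using s by (auto simp: cone_in_def)
  obtain k where k: "k \<in> mor C (sho C (- 1) (Cod C g)) z" "(k, s, g) \<in> Dist C"
    using rotate_back_ex[OF d(1) s(2)] by blast
  have "f \<star> k = azero C (sho C (- 1) (Cod C g)) x"
    using x cmp_mor[OF k(1) f] S_sho[OF d(2)] by (simp add: perp_def)
  then show ?thesis
    using dist_extend_along[OF k(2), of f x] f mor_DomCod[OF k(1)] mor_DomCod[OF s(2)] by auto
qed

section \<open>Roofs and their classes\<close>

lemma roofs_iff: "(s, f) \<in> roofs C S a b \<longleftrightarrow>
    s \<in> cone_in C S \<and> s \<in> mor C (Dom C s) a \<and> f \<in> mor C (Dom C s) b"
  using cone_in_mor by (auto simp: roofs_def mor_def)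

lemma roof_class_subset:
  assumes "r \<in> roofs C S a b" shows "roof_class C S r \<subseteq> roofs C S a b"
  using assms by (cases r) (auto simp: roof_class_def roofs_iff mor_def)

lemma roof_classI:
  assumes "(s', f') \<in> roofs C S (Cod C s) (Cod C f)"
    and u: "u \<in> mor C w (Dom C s)" and "u' \<in> mor C w (Dom C s')"
    and "s \<star> u = s' \<star> u'" "f \<star> u = f' \<star> u'" "s \<star> u \<in> cone_in C S"
  shows "(s', f') \<in> roof_class C S (s, f)"
  unfolding roof_class_def using assms mor_ObD(1)[OF u] by blast

lemma roof_class_refl:
  assumes "r \<in> roofs C S a b" shows "r \<in> roof_class C S r"
proof (cases r)
  case (Pair s f)
  with assms have *: "(s, f) \<in> roofs C S a b" by simp
  then have m: "s \<in> cone_in C S" "s \<in> mor C (Dom C s) a" "f \<in> mor C (Dom C s) b"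
    by (auto simp: roofs_iff)
  have i: "idn C (Dom C s) \<in> mor C (Dom C s) (Dom C s)"
    using mor_ObD(1)[OF m(2)] by (rule idn_mor)
  have e: "Cod C s = a" "Cod C f = b" using m by (auto simp: mor_def)
  show ?thesis
    unfolding Pair using * e cmp_idn_right[OF m(2)] m(1) by (intro roof_classI[OF _ i i]) simp_all
qed

text \<open>Source and target of a class are read off from an arbitrarily chosen member; all members
  share the ends of \<open>r\<close>.\<close>

lemma roof_class_ends:
  assumes "r \<in> roofs C S a b"
  shows "Dom (roof_category C S) (roof_class C S r) = a"
    "Cod (roof_category C S) (roof_class C S r) = b"
proof -
  let ?p = "SOME p. p \<in> roof_class C S r"
  have "?p \<in> roof_class C S r"
    using roof_class_refl[OF assms] by (rule someI)
  then have "?p \<in> roofs C S a b" using roof_class_subset[OF assms] by blast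
  then have "Cod C (fst ?p) = a" "Cod C (snd ?p) = b"
    by (cases ?p; auto simp: roofs_iff mor_def)+
  then show "Dom (roof_category C S) (roof_class C S r) = a"
    "Cod (roof_category C S) (roof_class C S r) = b"
    by (auto simp: roof_category_def)
qed

lemma mor_roof_category:
  assumes "a \<in> Ob C" "b \<in> Ob C"
  shows "mor (roof_category C S) a b = roof_class C S ` roofs C S a b"
proof (intro equalityI subsetI)
  fix x assume x: "x \<in> mor (roof_category C S) a b"
  then obtain r a' b' where r: "r \<in> roofs C S a' b'" "x = roof_class C S r"
    unfolding mor_def by (auto simp: roof_category_def)
  with x roof_class_ends[OF r(1)] show "x \<in> roof_class C S ` roofs C S a b"
    by (auto simp: mor_def)
next
  fix x assume "x \<in> roof_class C S ` roofs C S a b"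
  then obtain r where r: "r \<in> roofs C S a b" "x = roof_class C S r" by blast
  then have "x \<in> Arr (roof_category C S)"
    using assms unfolding roof_category_def tricat.simps by blast
  with r roof_class_ends[OF r(1)] show "x \<in> mor (roof_category C S) a b"
    by (simp add: mor_def)
qed

end

text \<open>Fixing a single replacement \<open>p\<close> allows the locale to be instantiated later
  with every shift of \<open>p\<close>, one for each degree of the Euler number.\<close>

locale local_replacement = triangulated_subcategory K C S
  for K :: "('k, 'r) ring_scheme" and C :: "('o, 'm, 'k) tricat" (structure) and S +
  fixes p :: 'm and b y :: 'o
  assumes p: "p \<in> cone_in C S" "p \<in> mor C b y" and y: "y \<in> perp"
begin

text \<open>As \<open>y\<close> is right orthogonal to \<open>S\<close>, for each roof \<open>(s, f)\<close> from \<open>a\<close> to \<open>b\<close> the arrow \<open>p \<star> f\<close>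
  extends uniquely along \<open>s\<close> to an arrow \<open>a \<rightarrow> y\<close>.  Two roofs are equivalent iff they give the same
  extension, so hom spaces of the quotient are hom spaces of \<open>C\<close> into \<open>y\<close>.\<close>

definition roofs_of :: "'o \<Rightarrow> 'm \<Rightarrow> ('m \<times> 'm) set" where
  "roofs_of a g = {(s, f) \<in> roofs C S a b. p \<star> f = g \<star> s}"

lemma roofs_of_ex:
  assumes r: "(s, f) \<in> roofs C S a b"
  shows "\<exists>g \<in> mor C a y. (s, f) \<in> roofs_of a g"
proof -
  have m: "s \<in> cone_in C S" "s \<in> mor C (Dom C s) a" "f \<in> mor C (Dom C s) b"
    using r by (auto simp: roofs_iff)
  from perp_extend[OF m(1,2) y cmp_mor[OF m(3) p(2)]]
  obtain g where "g \<in> mor C a y" "g \<star> s = p \<star> f" by blast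
  with r show ?thesis by (intro bexI[of _ g]) (auto simp: roofs_of_def)
qed

lemma roofs_of_inj:
  assumes "r \<in> roofs_of a g" "r \<in> roofs_of a g'" "g \<in> mor C a y" "g' \<in> mor C a y"
  shows "g = g'"
proof (cases r)
  case (Pair s f)
  with assms have "s \<in> cone_in C S" "s \<in> mor C (Dom C s) a" "g \<star> s = g' \<star> s"
    by (auto simp: roofs_of_def roofs_iff)
  then show ?thesis using perp_cancel y assms(3,4) by blast
qed

lemma roofs_of_class:
  assumes r: "r \<in> roofs_of a g" and g: "g \<in> mor C a y"
  shows "roof_class C S r = roofs_of a g"
proof (cases r)
  case (Pair s f)
  have sf: "(s, f) \<in> roofs C S a b" and pf: "p \<star> f = g \<star> s"
    using r Pair by (auto simp: roofs_of_def)
  have m: "s \<in> cone_in C S" "s \<in> mor C (Dom C s) a" "f \<in> mor C (Dom C s) b"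
    using sf by (auto simp: roofs_iff)
  have e: "Cod C s = a" "Cod C f = b" using m by (auto simp: mor_def)
  show ?thesis
  proof (intro equalityI subsetI)
    fix r' assume "r' \<in> roof_class C S r"
    then obtain s' f' w u u' where r': "r' = (s', f')" "(s', f') \<in> roofs C S a b"
      and u: "u \<in> mor C w (Dom C s)" "u' \<in> mor C w (Dom C s')"
      and eq: "s \<star> u = s' \<star> u'" "f \<star> u = f' \<star> u'" and su: "s \<star> u \<in> cone_in C S"
      unfolding Pair roof_class_def using e by auto
    obtain g' where g': "g' \<in> mor C a y" "(s', f') \<in> roofs_of a g'"
      using roofs_of_ex[OF r'(2)] by blast
    then have pf': "p \<star> f' = g' \<star> s'" by (auto simp: roofs_of_def)
    have m': "s' \<in> mor C (Dom C s') a" "f' \<in> mor C (Dom C s') b"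
      using r'(2) by (auto simp: roofs_iff)
    \<comment> \<open>The two extensions agree after composition with \<open>s \<star> u\<close>,
      which has its cone in \<open>S\<close>.\<close>
    have "g \<star> (s \<star> u) = p \<star> (f \<star> u)"
      using pf cmp_assoc[OF u(1) m(2) g] cmp_assoc[OF u(1) m(3) p(2)] by simp
    also have "\<dots> = g' \<star> (s \<star> u)"
      using pf' eq cmp_assoc[OF u(2) m'(1) g'(1)] cmp_assoc[OF u(2) m'(2) p(2)] by simp
    finally have "g = g'"
      using perp_cancel[OF su cmp_mor[OF u(1) m(2)] y g g'(1)] by simp
    with g' r' show "r' \<in> roofs_of a g" by simp
  next
    fix r' assume "r' \<in> roofs_of a g"
    then obtain s' f' where r': "r' = (s', f')" "(s', f') \<in> roofs C S a b"
      and pf': "p \<star> f' = g \<star> s'" by (auto simp: roofs_of_def)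
    then have m': "s' \<in> cone_in C S" "s' \<in> mor C (Dom C s') a" "f' \<in> mor C (Dom C s') b"
      by (auto simp: roofs_iff)
    obtain w u u' where u: "u \<in> mor C w (Dom C s')" "u' \<in> mor C w (Dom C s)"
      and su: "s' \<star> u = s \<star> u'" "u' \<in> cone_in C S"
      using ore_square[OF m'(1,2) m(2)] by blast
    note fu = cmp_mor[OF u(2) m(3)] cmp_mor[OF u(1) m'(3)]
    \<comment> \<open>After completing the left legs to a square, the right legs agree only up to
      \<open>p\<close>. Their difference \<open>d\<close> is killed by \<open>p\<close>, hence by a
      further refinement \<open>t\<close> with cone in \<open>S\<close>.\<close>
    define d where "d = aadd C (f \<star> u') (neg (f' \<star> u))"
    have d: "d \<in> mor C w b" unfolding d_def by (intro aadd_mor neg_mor fu)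
    have "p \<star> (f \<star> u') = p \<star> (f' \<star> u)"
      using pf pf' su cmp_assoc[OF u(2) m(2) g] cmp_assoc[OF u(2) m(3) p(2)]
        cmp_assoc[OF u(1) m'(2) g] cmp_assoc[OF u(1) m'(3) p(2)] by simp
    then have "p \<star> d = azero C w y"
      unfolding d_def using cmp_add_right[OF fu(1) neg_mor[OF fu(2)] p(2)]
        cmp_neg_right[OF fu(2) p(2)] add_neg[OF cmp_mor[OF fu(2) p(2)]] by simp
    then obtain w' t where t: "t \<in> mor C w' w" "t \<in> cone_in C S" "d \<star> t = azero C w' b"
      using cone_in_annihilator[OF p d] by blast
    note ut = cmp_mor[OF t(1) u(2)] cmp_mor[OF t(1) u(1)]
    have "f \<star> (u' \<star> t) = f' \<star> (u \<star> t)"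
    proof (rule eq_if_diff_zero[OF cmp_mor[OF ut(1) m(3)] cmp_mor[OF ut(2) m'(3)]])
      show "aadd C (f \<star> (u' \<star> t)) (neg (f' \<star> (u \<star> t))) = azero C w' b"
        using t(3) cmp_add_left[OF t(1) fu(1) neg_mor[OF fu(2)]] cmp_neg_left[OF t(1) fu(2)]
          cmp_assoc[OF t(1) u(2) m(3)] cmp_assoc[OF t(1) u(1) m'(3)] by (simp add: d_def)
    qed
    moreover have "s \<star> (u' \<star> t) = s' \<star> (u \<star> t)"
      using su(1) cmp_assoc[OF t(1) u(2) m(2)] cmp_assoc[OF t(1) u(1) m'(2)] by simp
    moreover have "s \<star> (u' \<star> t) \<in> cone_in C S"
      by (intro cone_in_cmp[OF _ ut(1) m(1,2)] cone_in_cmp[OF t(2,1) su(2) u(2)])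
    ultimately show "r' \<in> roof_class C S r"
      unfolding Pair r'(1) using e r'(2) by (intro roof_classI[OF _ ut]) simp_all
  qed
qed

text \<open>Addition in the quotient needs representatives with the same left leg. The case of equal
  arrows also shows that \<open>roofs_of a g\<close> is nonempty.\<close>

lemma roofs_of_common:
  assumes "g \<in> mor C a y" "g' \<in> mor C a y"
  shows "\<exists>s f f'. (s, f) \<in> roofs_of a g \<and> (s, f') \<in> roofs_of a g'"
proof -
  obtain w u u' where 1: "u \<in> mor C w b" "u' \<in> mor C w a" "p \<star> u = g \<star> u'" "u' \<in> cone_in C S"
    using ore_square[OF p assms(1)] by blast
  \<comment> \<open>The second square starts from \<open>g' \<star> u'\<close>, so that
    \<open>u' \<star> v'\<close> can serve as left leg for both arrows.\<close>
  obtain x v v' where 2: "v \<in> mor C x b" "v' \<in> mor C x w" "p \<star> v = (g' \<star> u') \<star> v'" "v' \<in> cone_in C S"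
    using ore_square[OF p cmp_mor[OF 1(2) assms(2)]] by blast
  have s: "u' \<star> v' \<in> cone_in C S" "u' \<star> v' \<in> mor C x a"
    using cone_in_cmp[OF 2(4,2) 1(4,2)] cmp_mor[OF 2(2) 1(2)] by auto
  have "(u' \<star> v', u \<star> v') \<in> roofs_of a g"
    using s cmp_mor[OF 2(2) 1(1)] cmp_assoc[OF 2(2) 1(1) p(2)] cmp_assoc[OF 2(2) 1(2) assms(1)] 1(3)
    by (simp add: roofs_of_def roofs_iff mor_DomCod[OF s(2)])
  moreover have "(u' \<star> v', v) \<in> roofs_of a g'"
    using s 2(1,3) cmp_assoc[OF 2(2) 1(2) assms(2)]
    by (simp add: roofs_of_def roofs_iff mor_DomCod[OF s(2)])
  ultimately show ?thesis by blast
qed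

lemma roofs_of_nonempty: "g \<in> mor C a y \<Longrightarrow> roofs_of a g \<noteq> {}"
  using roofs_of_common by blast

lemma bij_roofs_of:
  assumes "a \<in> Ob C"
  shows "bij_betw (roofs_of a) (mor C a y) (mor (roof_category C S) a b)"
proof (rule bij_betw_imageI)
  show "inj_on (roofs_of a) (mor C a y)"
  proof (rule inj_onI)
    fix g g' assume g: "g \<in> mor C a y" "g' \<in> mor C a y" "roofs_of a g = roofs_of a g'"
    with roofs_of_nonempty[OF g(1)] show "g = g'" using roofs_of_inj[of _ a g g'] by auto
  qed
  show "roofs_of a ` mor C a y = mor (roof_category C S) a b"
    unfolding mor_roof_category[OF assms mor_ObD(1)[OF p(2)]]
  proof (intro equalityI subsetI)
    fix F assume "F \<in> roofs_of a ` mor C a y"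
    then obtain g where g: "g \<in> mor C a y" "F = roofs_of a g" by blast
    then obtain r where r: "r \<in> roofs_of a g" using roofs_of_nonempty by blast
    then have "r \<in> roofs C S a b" by (auto simp: roofs_of_def)
    with roofs_of_class[OF r g(1)] g(2) show "F \<in> roof_class C S ` roofs C S a b" by auto
  next
    fix F assume "F \<in> roof_class C S ` roofs C S a b"
    then obtain r where r: "r \<in> roofs C S a b" "F = roof_class C S r" by blast
    then obtain g where "g \<in> mor C a y" "r \<in> roofs_of a g"
      using roofs_of_ex[of "fst r" "snd r" a] by auto
    with r(2) roofs_of_class show "F \<in> roofs_of a ` mor C a y" by auto
  qed
qed

lemma roofs_of_azero:
  assumes "a \<in> Ob C"
  shows "azero (roof_category C S) a b = roofs_of a (azero C a y)"
proof -
  have b: "b \<in> Ob C" "y \<in> Ob C" using p(2) mor_ObD by blast+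
  have i: "idn C a \<in> mor C a a" by (rule idn_mor[OF assms])
  have z: "azero C a b \<in> mor C a b" "azero C a y \<in> mor C a y" by (intro azero_mor assms b)+
  have "(idn C a, azero C a b) \<in> roofs_of a (azero C a y)"
    using idn_cone_in[OF assms] i z cmp_azero_right[OF p(2) assms] cmp_idn_right[OF z(2)]
    by (simp add: roofs_of_def roofs_iff mor_DomCod[OF i])
  from roofs_of_class[OF this z(2)] show ?thesis by (simp add: roof_category_def)
qed

lemma roofs_of_aadd:
  assumes g: "g \<in> mor C a y" "g' \<in> mor C a y"
  shows "aadd (roof_category C S) (roofs_of a g) (roofs_of a g') = roofs_of a (aadd C g g')"
proof -
  have "roof_class C S (s, aadd C f f') = roofs_of a (aadd C g g')"
    if "(s, f) \<in> roofs_of a g" "(s, f') \<in> roofs_of a g'" for s f f'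
  proof (rule roofs_of_class[OF _ aadd_mor[OF g]])
    have m: "s \<in> cone_in C S" "s \<in> mor C (Dom C s) a" "f \<in> mor C (Dom C s) b" "f' \<in> mor C (Dom C s) b"
      and eq: "p \<star> f = g \<star> s" "p \<star> f' = g' \<star> s"
      using that by (auto simp: roofs_of_def roofs_iff)
    show "(s, aadd C f f') \<in> roofs_of a (aadd C g g')"
      using m(1,2) aadd_mor[OF m(3,4)] eq cmp_add_right[OF m(3,4) p(2)] cmp_add_left[OF m(2) g]
      by (simp add: roofs_of_def roofs_iff)
  qed
  \<comment> \<open>All admissible choices give one class and some choice exists, so the union
    defining the sum collapses.\<close>
  then have "{roof_class C S (s, aadd C f f') | s f f'. (s, f) \<in> roofs_of a g \<and> (s, f') \<in> roofs_of a g'} =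
      {roofs_of a (aadd C g g')}"
    using roofs_of_common[OF g] by blast
  then show ?thesis by (simp add: roof_category_def)
qed

lemma roofs_of_ascale:
  assumes k: "k \<in> carrier K" and g: "g \<in> mor C a y"
  shows "ascale (roof_category C S) k (roofs_of a g) = roofs_of a (ascale C k g)"
proof -
  have "roof_class C S (s, ascale C k f) = roofs_of a (ascale C k g)"
    if "(s, f) \<in> roofs_of a g" for s f
  proof (rule roofs_of_class[OF _ ascale_mor[OF k g]])
    have m: "s \<in> cone_in C S" "s \<in> mor C (Dom C s) a" "f \<in> mor C (Dom C s) b"
      and eq: "p \<star> f = g \<star> s"
      using that by (auto simp: roofs_of_def roofs_iff)
    show "(s, ascale C k f) \<in> roofs_of a (ascale C k g)"
      using m(1,2) ascale_mor[OF k m(3)] eq cmp_scale_right[OF k m(3) p(2)] cmp_scale_left[OF k m(2) g]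
      by (simp add: roofs_of_def roofs_iff)
  qed
  then have "{roof_class C S (s, ascale C k f) | s f. (s, f) \<in> roofs_of a g} = {roofs_of a (ascale C k g)}"
    using roofs_of_nonempty[OF g] by fast
  then show ?thesis by (simp add: roof_category_def)
qed

end

lemma mor_space_simps:
  "carrier (mor_space C a b) = mor C a b" "\<zero>\<^bsub>mor_space C a b\<^esub> = azero C a b"
  "add (mor_space C a b) = aadd C" "smult (mor_space C a b) = ascale C"
  by (simp_all add: mor_space_def)

lemma verdier_quotient_simps:
  "Ob (verdier_quotient C S) = Ob C" "Arr (verdier_quotient C S) = Arr (roof_category C S)"
  "Dom (verdier_quotient C S) = Dom (roof_category C S)" "Cod (verdier_quotient C S) = Cod (roof_category C S)"
  "mor (verdier_quotient C S) a b = mor (roof_category C S) a b"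
  "mor_space (verdier_quotient C S) a b = mor_space (roof_category C S) a b"
  "azero (verdier_quotient C S) = azero (roof_category C S)"
  "sho (verdier_quotient C S) = sho C"
  by (simp_all add: verdier_quotient_def Let_def mor_def mor_space_def roof_category_def)

lemma (in local_replacement) dim_roof_mor_space:
  assumes a: "a \<in> Ob C" and fin: "vectorspace.fin_dim K (mor_space C a y)"
  shows "vectorspace.dim K (mor_space (roof_category C S) a b) = vectorspace.dim K (mor_space C a y)"
proof (rule vectorspace_dim_transport[OF _ fin])
  show "vectorspace K (mor_space C a y)"
    by (rule mor_vectorspace[OF a mor_ObD(2)[OF p(2)]])
qed (simp_all add: mor_space_simps bij_roofs_of[OF a] roofs_of_azero[OF a] roofs_of_aadd roofs_of_ascale)

lemma (in local_replacement) trivial_roof_mor: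
  assumes a: "a \<in> Ob C"
  shows "mor (roof_category C S) a b = {azero (roof_category C S) a b} \<longleftrightarrow> mor C a y = {azero C a y}"
proof -
  have z: "azero C a y \<in> mor C a y" by (rule azero_mor[OF a mor_ObD(2)[OF p(2)]])
  have "mor (roof_category C S) a b = roofs_of a ` mor C a y" "inj_on (roofs_of a) (mor C a y)"
    using bij_roofs_of[OF a] by (auto simp: bij_betw_def)
  then show ?thesis
    using z inj_on_image_eq_iff[of "roofs_of a" "mor C a y" "mor C a y" "{azero C a y}"]
    by (auto simp: roofs_of_azero[OF a])
qed

section \<open>Euler numbers of the quotient and the subcategory; the coreflection into
  \<open>S\<close>\<close>

context triangulated_subcategory
begin

text \<open>Each shift of \<open>p\<close> is again a replacement, so dimensions agree in every
  degree and both sums run over the same degrees.\<close>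

lemma euler_number_verdier_quotient:
  assumes p: "p \<in> cone_in C S" "p \<in> mor C b y" and y: "y \<in> perp" and a: "a \<in> Ob C"
    and fin: "total_hom_finite K C"
  shows "euler_number K (verdier_quotient C S) a b = euler_number K C a y"
proof -
  have L: "local_replacement K C S (sha C n p) (sho C n b) (sho C n y)" for n
    by (intro local_replacement.intro local_replacement_axioms.intro triangulated_subcategory_axioms
      cone_in_sha[OF p(1)] sha_mor[OF p(2)] perp_sho[OF y])
  have "vectorspace.fin_dim K (mor_space C a (sho C n y))" for n
    using fin a mor_ObD(2)[OF p(2)] by (simp add: total_hom_finite_def)
  then have "vectorspace.dim K (mor_space (verdier_quotient C S) a (sho (verdier_quotient C S) n b)) =
      vectorspace.dim K (mor_space C a (sho C n y))" for n
    unfolding verdier_quotient_simps by (rule local_replacement.dim_roof_mor_space[OF L a])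
  moreover have "nonzero_degrees (verdier_quotient C S) a b = nonzero_degrees C a y"
    by (simp only: nonzero_degrees_def verdier_quotient_simps local_replacement.trivial_roof_mor[OF L a])
  ultimately show ?thesis by (simp only: euler_number_def)
qed

lemma mor_full_subcategory:
  "\<lbrakk>a \<in> S; b \<in> S\<rbrakk> \<Longrightarrow> mor (full_subcategory C S) a b = mor C a b"
  by (auto simp: full_subcategory_def mor_def)

lemma euler_number_full_subcategory:
  assumes "a \<in> S" "b \<in> S"
  shows "euler_number K (full_subcategory C S) a b = euler_number K C a b"
proof -
  have *: "sho (full_subcategory C S) = sho C" "azero (full_subcategory C S) = azero C"
    by (simp_all add: full_subcategory_def)
  have m: "mor (full_subcategory C S) a (sho C n b) = mor C a (sho C n b)" for n
    by (rule mor_full_subcategory[OF assms(1) S_sho[OF assms(2)]])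
  have "aadd (full_subcategory C S) = aadd C" "ascale (full_subcategory C S) = ascale C"
    by (simp_all add: full_subcategory_def)
  then have "mor_space (full_subcategory C S) a (sho C n b) = mor_space C a (sho C n b)" for n
    by (simp only: mor_space_def m *)
  then show ?thesis
    by (simp only: euler_number_def nonzero_degrees_def * m)
qed

lemma euler_number_perp:
  assumes "a \<in> S" "y \<in> perp"
  shows "euler_number K C a y = 0"
proof -
  have "mor C a (sho C n y) = {azero C a (sho C n y)}" for n
  proof -
    have "sho C n y \<in> Ob C" "\<forall>f \<in> mor C a (sho C n y). f = azero C a (sho C n y)"
      using assms(1) perp_sho[OF assms(2), of n] unfolding perp_def by blast+
    then show ?thesis using azero_mor[OF S_Ob[OF assms(1)]] by blast
  qed
  then have "nonzero_degrees C a y = {}" by (simp add: nonzero_degrees_def)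
  then show ?thesis by (simp add: euler_number_def)
qed

lemma coreflection:
  assumes adj: "is_right_adjoint (full_subcategory C S) C inclusion_functor G" and b: "b \<in> Ob C"
  obtains r e where "r \<in> S" "e \<in> mor C r b"
    and "\<And>a. a \<in> S \<Longrightarrow> bij_betw (\<lambda>u. e \<star> u) (mor C a r) (mor C a b)"
proof -
  let ?F = "full_subcategory C S"
  let ?r = "fob G b"
  have F_simps: "Ob ?F = S" "cmp ?F = cmp C" "idn ?F = idn C"
    by (simp_all add: full_subcategory_def)
  obtain \<Phi> where "\<forall>a \<in> S. \<forall>d \<in> Ob C. bij_betw (\<Phi> a d) (mor C a d) (mor ?F a (fob G d))"
    and "\<forall>a \<in> S. \<forall>a' \<in> S. \<forall>d \<in> Ob C. \<forall>d' \<in> Ob C.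
      \<forall>u \<in> mor ?F a' a. \<forall>x \<in> mor C a d. \<forall>v \<in> mor C d d'.
        \<Phi> a' d' (v \<star> x \<star> u) = farr G v \<star> \<Phi> a d x \<star> u"
    using adj unfolding is_right_adjoint_def inclusion_functor_def functor_data.simps F_simps by blast
  then have bij: "\<And>a d. \<lbrakk>a \<in> S; d \<in> Ob C\<rbrakk> \<Longrightarrow> bij_betw (\<Phi> a d) (mor C a d) (mor ?F a (fob G d))"
    and nat: "\<And>a a' d d' u x v. \<lbrakk>a \<in> S; a' \<in> S; d \<in> Ob C; d' \<in> Ob C; u \<in> mor ?F a' a;
      x \<in> mor C a d; v \<in> mor C d d'\<rbrakk> \<Longrightarrow>
      \<Phi> a' d' (v \<star> x \<star> u) = farr G v \<star> \<Phi> a d x \<star> u"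
    by simp_all
  have G: "fob G d \<in> S" "farr G (idn C d) = idn C (fob G d)" if "d \<in> Ob C" for d
    using adj that unfolding is_right_adjoint_def is_functor_def F_simps by blast+
  have r: "?r \<in> S" by (rule G[OF b])
  have id: "idn C ?r \<in> mor C ?r ?r" "idn C b \<in> mor C b b" by (intro idn_mor S_Ob[OF r] b)+
  have "\<Phi> ?r b ` mor C ?r b = mor C ?r ?r"
    using bij_betw_imp_surj_on[OF bij[OF r b]] mor_full_subcategory[OF r r] by simp
  then have "idn C ?r \<in> \<Phi> ?r b ` mor C ?r b" using id(1) by simp
  \<comment> \<open>\<open>e\<close> is the counit at \<open>b\<close>: the arrow that the
    adjunction sends to the identity of \<open>?r\<close>.\<close>
  then obtain e where e: "e \<in> mor C ?r b" "\<Phi> ?r b e = idn C ?r" by fastforce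
  have inv: "\<Phi> a b (e \<star> u) = u" if a: "a \<in> S" and u: "u \<in> mor C a ?r" for a u
  proof -
    \<comment> \<open>Naturality in the first variable shows that \<open>\<Phi> a b\<close> undoes
      composition with the counit.\<close>
    have "\<Phi> a b (idn C b \<star> e \<star> u) = farr G (idn C b) \<star> \<Phi> ?r b e \<star> u"
      using nat[OF r a b b _ e(1) id(2)] mor_full_subcategory[OF a r] u by simp
    then show ?thesis
      using cmp_idn_left[OF e(1)] cmp_idn_left[OF u] cmp_idn_left[OF id(1)] G[OF b] e(2) by simp
  qed
  have "bij_betw (\<lambda>u. e \<star> u) (mor C a ?r) (mor C a b)" if a: "a \<in> S" for a
  proof (rule bij_betw_byWitness[where f' = "\<Phi> a b"])
    have b': "bij_betw (\<Phi> a b) (mor C a b) (mor C a ?r)"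
      using bij[OF a b] mor_full_subcategory[OF a r] by simp
    show "\<forall>u \<in> mor C a ?r. \<Phi> a b (e \<star> u) = u" using inv[OF a] by blast
    show im: "(\<lambda>u. e \<star> u) ` mor C a ?r \<subseteq> mor C a b" using cmp_mor e(1) by blast
    show "\<Phi> a b ` mor C a b \<subseteq> mor C a ?r" using b' by (auto simp: bij_betw_def)
    then have \<Phi>x: "\<Phi> a b x \<in> mor C a ?r" if "x \<in> mor C a b" for x using that by blast
    show "\<forall>x \<in> mor C a b. e \<star> \<Phi> a b x = x"
    proof
      fix x assume x: "x \<in> mor C a b"
      show "e \<star> \<Phi> a b x = x"
        by (rule inj_onD[OF bij_betw_imp_inj_on[OF b'] inv[OF a \<Phi>x[OF x]] cmp_mor[OF \<Phi>x[OF x] e(1)] x])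
    qed
  qed
  with r e(1) show ?thesis by (rule that)
qed

text \<open>Let \<open>f\<close> go from an object \<open>a\<close> of \<open>S\<close> to the cone
  of the counit \<open>e\<close>. Injectivity of composition with \<open>e\<close> on arrows from
  \<open>a[-1]\<close> forces \<open>h \<star> f\<close> to vanish, so \<open>f\<close> lifts along
  \<open>p\<close> to \<open>b\<close>. By surjectivity on arrows from \<open>a\<close> this lift
  factors through \<open>e\<close>, and \<open>p \<star> e\<close> is zero.\<close>

lemma coreflection_triangle:
  assumes adj: "is_right_adjoint (full_subcategory C S) C inclusion_functor G" and b: "b \<in> Ob C"
  obtains e p h where "(e, p, h) \<in> Dist C" "Dom C e \<in> S" "Cod C e = b" "Cod C p \<in> perp"
    "p \<in> cone_in C S"
proof -
  obtain r e where r: "r \<in> S" and e: "e \<in> mor C r b"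
    and bij: "\<And>a. a \<in> S \<Longrightarrow> bij_betw (\<lambda>u. e \<star> u) (mor C a r) (mor C a b)"
    by (rule coreflection[OF assms]) blast
  obtain p h where d: "(e, p, h) \<in> Dist C" using TR1_cone[of e] e by (auto simp: mor_def)
  let ?c = "Cod C p"
  have p: "p \<in> mor C b ?c" and h: "h \<in> mor C ?c (sho C 1 r)"
    using dist_mors[OF d] mor_DomCod[OF e] by simp_all
  have pe: "p \<star> e = azero C r ?c"
    using dist_cmp_azero[OF d] mor_DomCod[OF e] by simp
  note d' = rotate[OF d]
  have he: "neg (sha C 1 e) \<star> h = azero C ?c (sho C 1 b)"
    using dist_cmp_azero[OF rotate[OF d']] mor_DomCod[OF h]
      mor_DomCod[OF neg_mor[OF sha_mor[OF e]], of 1] by simp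
  have "f = azero C a ?c" if a: "a \<in> S" and f: "f \<in> mor C a ?c" for a f
  proof -
    have aOb: "a \<in> Ob C" by (rule S_Ob[OF a])
    have hf: "h \<star> f \<in> mor C a (sho C 1 r)" by (rule cmp_mor[OF f h])
    have e1: "sha C 1 e \<in> mor C (sho C 1 r) (sho C 1 b)" by (rule sha_mor[OF e])
    define u where "u = sha C (- 1) (h \<star> f)"
    have u: "u \<in> mor C (sho C (- 1) a) r"
      using sha_mor[OF hf, of "- 1"] sho_minus_sho[OF S_Ob[OF r], of 1] by (simp add: u_def)
    have a': "sho C (- 1) a \<in> S" by (rule S_sho[OF a])
    have u1: "sha C 1 u = h \<star> f" unfolding u_def using sha_sha_minus[OF hf, of 1] by simp
    have "neg (sha C 1 e \<star> (h \<star> f)) = azero C a (sho C 1 b)"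
      using he cmp_assoc[OF f h neg_mor[OF e1]] cmp_neg_left[OF hf e1]
        cmp_azero_left[OF f sho_Ob[OF b, of 1]] by simp
    then have "sha C 1 e \<star> (h \<star> f) = azero C a (sho C 1 b)"
      using neg_neg[OF cmp_mor[OF hf e1]] neg_azero[OF aOb sho_Ob[OF b, of 1]] by simp
    then have "sha C 1 (e \<star> u) = azero C (sho C 1 (sho C (- 1) a)) (sho C 1 b)"
      using sha_cmp[OF u e, of 1] u1 sho_sho_minus[OF aOb, of 1] by simp
    then have "e \<star> u = azero C (sho C (- 1) a) b"
      by (rule sha_eq_azeroD[OF cmp_mor[OF u e]])
    moreover have "e \<star> azero C (sho C (- 1) a) r = azero C (sho C (- 1) a) b"
      by (rule cmp_azero_right[OF e S_Ob[OF a']])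
    ultimately have "u = azero C (sho C (- 1) a) r"
      using inj_on_eq_iff[OF bij_betw_imp_inj_on[OF bij[OF a']] u azero_mor[OF S_Ob[OF a'] S_Ob[OF r]]]
      by simp
    then have "h \<star> f = azero C a (sho C 1 r)"
      using u1 sha_azero[OF S_Ob[OF a'] S_Ob[OF r], of 1] sho_sho_minus[OF aOb, of 1] by simp
    then obtain v where v: "v \<in> mor C a b" "p \<star> v = f"
      using dist_factor_through[OF d', of f a] f mor_DomCod[OF p] mor_DomCod[OF h] by auto
    then obtain w where w: "w \<in> mor C a r" "v = e \<star> w"
      using bij[OF a] by (auto simp: bij_betw_def)
    have "f = (p \<star> e) \<star> w" using v w cmp_assoc[OF w(1) e p] by simp
    then show ?thesis
      using pe cmp_azero_left[OF w(1) mor_ObD(2)[OF p]] by simp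
  qed
  then have "?c \<in> perp" using mor_ObD(2)[OF p] by (simp add: perp_def)
  \<comment> \<open>By rotation the cone of \<open>p\<close> is the shift of
    \<open>r\<close>.\<close>
  moreover have "p \<in> cone_in C S"
    using d' S_sho[OF r, of 1] mor_DomCod[OF h] unfolding cone_in_def by auto
  ultimately show ?thesis
    using that[OF d] r mor_DomCod[OF e] by simp
qed

lemma Arr_roof_category_ends:
  assumes "F \<in> Arr (roof_category C S)"
  shows "Dom (roof_category C S) F \<in> Ob C" "Cod (roof_category C S) F \<in> Ob C"
proof -
  obtain r a b where "a \<in> Ob C" "b \<in> Ob C" "r \<in> roofs C S a b" "F = roof_class C S r"
    using assms by (auto simp: roof_category_def)
  with roof_class_ends show "Dom (roof_category C S) F \<in> Ob C" "Cod (roof_category C S) F \<in> Ob C"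
    by auto
qed

lemma Dist_verdier_quotient_ends:
  assumes "(f, g, h) \<in> Dist (verdier_quotient C S)"
  shows "Dom (verdier_quotient C S) f \<in> Ob C \<and> Cod (verdier_quotient C S) f \<in> Ob C \<and>
    Cod (verdier_quotient C S) g \<in> Ob C"
proof -
  have "triangle (roof_category C S) (f, g, h)"
    using assms by (auto simp: verdier_quotient_def Let_def triangle_iso_def)
  then show ?thesis
    using Arr_roof_category_ends by (simp add: verdier_quotient_simps)
qed

end

section \<open>The exact sequence of numerical groups\<close>

theorem theorem1p1:
  fixes K :: "('k, 'r) ring_scheme"
    and T :: "('o, 'm, 'k) tricat"
    and S :: "'o set"
  assumes "klinear_triangulated_category K T"
    and "strictly_full_triangulated_subcategory T S"
    and "numerical_K0_exists K T"
    and "numerical_K0_exists K (full_subcategory T S)"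
    and "numerical_K0_exists K (verdier_quotient T S)"
    and "\<exists>q_star. is_right_adjoint T (verdier_quotient T S) (quotient_functor T S) q_star"
    and "\<exists>i_star. is_right_adjoint (full_subcategory T S) T inclusion_functor i_star"
  shows "\<exists>\<phi> \<psi>.
    induces_on_K0_num K (full_subcategory T S) T inclusion_functor \<phi> \<and>
    induces_on_K0_num K T (verdier_quotient T S) (quotient_functor T S) \<psi> \<and>
    exact_seq
      ([singleton_group \<one>\<^bsub>K0_num K (verdier_quotient T S)\<^esub>,
        K0_num K (verdier_quotient T S), K0_num K T, K0_num K (full_subcategory T S)],
       [\<lambda>x. \<one>\<^bsub>K0_num K (verdier_quotient T S)\<^esub>, \<psi>, \<phi>])"
proof -
  let ?F = "full_subcategory T S" and ?Q = "verdier_quotient T S"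
  interpret triangulated_subcategory K T S
    using assms(1,2) by (simp add: triangulated_subcategory_def triangulated_subcategory_axioms_def)
  have ObF: "Ob ?F = S" and DistF: "\<And>f g h. (f, g, h) \<in> Dist ?F \<Longrightarrow>
      Dom ?F f \<in> S \<and> Cod ?F f \<in> S \<and> Cod ?F g \<in> S"
    by (auto simp: full_subcategory_def)
  have NT: "numerical_K0 K T"
    using assms(3) dist_mors mor_ObD by unfold_locales blast+
  have NF: "numerical_K0 K ?F"
    using assms(4) DistF ObF by unfold_locales auto
  have NQ: "numerical_K0 K ?Q"
    using assms(5) Dist_verdier_quotient_ends by unfold_locales (auto simp: verdier_quotient_simps(1))
  have fin: "total_hom_finite K T"
    using assms(3) by (simp add: numerical_K0_exists_def euler_form_well_defined_def)
  obtain i_star where adj: "is_right_adjoint ?F T inclusion_functor i_star"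
    using assms(7) by blast
  have "\<exists>e p h. (e, p, h) \<in> Dist T \<and> Dom T e \<in> S \<and> Cod T e = b \<and> Cod T p \<in> perp \<and> p \<in> cone_in T S"
    if "b \<in> Ob T" for b
    using coreflection_triangle[OF adj that] by metis
  then obtain e p h where d: "\<And>b. b \<in> Ob T \<Longrightarrow> (e b, p b, h b) \<in> Dist T"
    and Dom_e: "\<And>b. b \<in> Ob T \<Longrightarrow> Dom T (e b) \<in> S" and eb: "\<And>b. b \<in> Ob T \<Longrightarrow> Cod T (e b) = b"
    and perp: "\<And>b. b \<in> Ob T \<Longrightarrow> Cod T (p b) \<in> perp" and cone: "\<And>b. b \<in> Ob T \<Longrightarrow> p b \<in> cone_in T S"
    by metis
  have pm: "p b \<in> mor T b (Cod T (p b))" if "b \<in> Ob T" for b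
    using dist_mors(2)[OF d[OF that]] eb[OF that] by simp
  interpret S: numerical_K0 K ?F by (rule NF)
  interpret T: numerical_K0 K T by (rule NT)
  interpret Q: numerical_K0 K ?Q by (rule NQ)
  define r where "r b = Dom T (e b)" for b
  define c where "c b = Cod T (p b)" for b
  have r: "r b \<in> Ob ?F" and c: "c b \<in> Ob T" and c_perp: "c b \<in> perp" if "b \<in> Ob T" for b
    using that Dom_e perp by (auto simp: r_def c_def perp_def ObF)
  have ObS: "Ob ?F \<subseteq> Ob T" and ObQ: "Ob ?Q = Ob T"
    using S_Ob by (auto simp: verdier_quotient_simps(1) ObF)
  have ES: "euler_number K ?F a d = euler_number K T a d" if "a \<in> Ob ?F" "d \<in> Ob ?F" for a d
    using that unfolding ObF by (rule euler_number_full_subcategory)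
  have orth: "euler_number K T a (c b) = 0" if "a \<in> Ob ?F" "b \<in> Ob T" for a b
    using that c_perp unfolding ObF by (intro euler_number_perp)
  have EQ: "euler_number K ?Q a b = euler_number K T a (c b)" if "a \<in> Ob T" "b \<in> Ob T" for a b
    unfolding c_def using that by (intro euler_number_verdier_quotient[OF cone pm perp _ fin])
  have left: "euler_number K T b a = euler_number K T (r b) a + euler_number K T (c b) a"
    and right: "euler_number K T a b = euler_number K T a (r b) + euler_number K T a (c b)"
    if "a \<in> Ob T" "b \<in> Ob T" for a b
    using T.euler_number_triangle[OF d[OF that(2)] that(1)] eb[OF that(2)] by (simp_all add: r_def c_def)
  let ?E = "euler_number K T"
  let ?keys = Poly_Mapping.keys
  have S_T: "T.num_cls x = \<one>\<^bsub>K0_num K T\<^esub>"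
    if x: "?keys x \<subseteq> Ob ?F" and 1: "S.num_cls x = \<one>\<^bsub>K0_num K ?F\<^esub>" for x
  proof -
    have "frag_eval (\<lambda>a. ?E a b) x = 0" if b: "b \<in> Ob T" for b
    proof -
      have "frag_eval (\<lambda>a. ?E a b) x = frag_eval (\<lambda>a. euler_number K ?F a (r b)) x"
        using ObS r[OF b] right[OF _ b] orth[OF _ b] ES[OF _ r[OF b]]
        by (intro frag_eval_cong[OF x]) (auto simp: subset_iff)
      with S.num_cls_eq_one_left[OF x] 1 r[OF b] show ?thesis by simp
    qed
    then show ?thesis
      using T.num_cls_eq_one_left[of x] x ObS by auto
  qed
  have EQx: "frag_eval (\<lambda>a. euler_number K ?Q a b) x = frag_eval (\<lambda>a. ?E a (c b)) x"
    if "?keys x \<subseteq> Ob T" "b \<in> Ob T" for x b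
    using that EQ by (intro frag_eval_cong[OF that(1)]) auto
  have T_Q: "Q.num_cls x = \<one>\<^bsub>K0_num K ?Q\<^esub>"
    if x: "?keys x \<subseteq> Ob T" and 1: "T.num_cls x = \<one>\<^bsub>K0_num K T\<^esub>" for x
    using x 1 Q.num_cls_eq_one_left[of x] T.num_cls_eq_one_left[of x] by (simp add: ObQ EQx c)
  obtain \<phi> where \<phi>: "\<phi> \<in> hom (K0_num K ?F) (K0_num K T)"
    and \<phi>_cls: "\<And>x. ?keys x \<subseteq> Ob ?F \<Longrightarrow> \<phi> (S.num_cls x) = T.num_cls x"
    using bexE[OF induced_hom_K0_num[OF NF NT ObS S_T]] by metis
  obtain \<psi> where \<psi>: "\<psi> \<in> hom (K0_num K T) (K0_num K ?Q)"
    and \<psi>_cls: "\<And>x. ?keys x \<subseteq> Ob T \<Longrightarrow> \<psi> (T.num_cls x) = Q.num_cls x"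
    using bexE[OF induced_hom_K0_num[OF NT NQ equalityD2[OF ObQ] T_Q]] by metis
  have surj: "\<psi> ` carrier (K0_num K T) = carrier (K0_num K ?Q)"
    unfolding T.num_cls_surj Q.num_cls_surj ObQ image_image by (intro image_cong) (auto simp: \<psi>_cls)
  have ker1: "Q.num_cls x = \<one>\<^bsub>K0_num K ?Q\<^esub>" if x: "?keys x \<subseteq> Ob ?F" for x
  proof -
    have "frag_eval (\<lambda>a. euler_number K ?Q a b) x = 0" if b: "b \<in> Ob ?Q" for b
      using frag_eval_cong[OF x, of "\<lambda>a. euler_number K ?Q a b" "\<lambda>a. 0"] EQ orth ObQ ObS b
      by (auto simp: frag_eval_zero_fun subset_iff)
    then show ?thesis
      using Q.num_cls_eq_one_left[of x] x ObS ObQ by auto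
  qed
  have ker2: "\<exists>y. ?keys y \<subseteq> Ob ?F \<and> T.num_cls x = T.num_cls y"
    if x: "?keys x \<subseteq> Ob T" and 1: "Q.num_cls x = \<one>\<^bsub>K0_num K ?Q\<^esub>" for x
  proof -
    \<comment> \<open>\<open>y\<close> and \<open>z\<close> are \<open>r\<close> and
      \<open>c\<close> extended linearly from objects to the formal combination
      \<open>x\<close>.\<close>
    define y where "y = frag_extend (\<lambda>a. frag_of (r a)) x"
    define z where "z = frag_extend (\<lambda>a. frag_of (c a)) x"
    have y: "?keys y \<subseteq> Ob ?F" and z: "?keys z \<subseteq> Ob T"
      unfolding y_def z_def by (intro keys_frag_extend_of[OF x] r c; assumption)+
    then have yT: "?keys y \<subseteq> Ob T" using ObS by auto
    have xy: "?keys (x - y) \<subseteq> Ob T"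
      using x yT by (auto dest: subsetD[OF keys_diff])
    then have xyz: "?keys (x - y - z) \<subseteq> Ob T"
      using z keys_diff[of "x - y" z] by blast
    have "frag_eval (?E a) z = 0" if a: "a \<in> Ob T" for a
    proof -
      \<comment> \<open>Pairing \<open>a\<close> with \<open>z\<close> in \<open>T\<close> is
        pairing \<open>a\<close> with \<open>x\<close> in the quotient; it vanishes because
        triviality of \<open>x\<close> there may be tested on the right.\<close>
      have "frag_eval (?E a) z = frag_eval (euler_number K ?Q a) x"
        unfolding z_def frag_eval_frag_extend
        by (intro frag_eval_cong[OF x]) (simp add: EQ[OF a])
      with Q.num_cls_eq_one_right[of x] x 1 a ObQ show ?thesis by simp
    qed
    then have z1: "T.num_cls z = \<one>\<^bsub>K0_num K T\<^esub>"
      using T.num_cls_eq_one_right[OF z] by simp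
    \<comment> \<open>Additivity on the triangles of the single objects, summed over
      \<open>x\<close>; together with the triviality of \<open>z\<close> it identifies
      \<open>x\<close> with \<open>y\<close> numerically.\<close>
    have "frag_eval (\<lambda>a. ?E a b) (x - y - z) = 0" if b: "b \<in> Ob T" for b
      using frag_eval_cong[OF x, of "\<lambda>a. ?E a b" "\<lambda>a. ?E (r a) b + ?E (c a) b", OF left[OF b]]
      by (simp add: y_def z_def frag_eval_frag_extend frag_eval_add_fun)
    then have "T.num_cls (x - y) = T.num_cls z"
      using T.num_cls_eq_one_left[OF xyz] T.num_cls_diff[OF xy z] by simp
    then have "T.num_cls x = T.num_cls y"
      using z1 T.num_cls_diff[OF x yT] by simp
    with y show ?thesis by blast
  qed
  have ker: "kernel (K0_num K T) (K0_num K ?Q) \<psi> = \<phi> ` carrier (K0_num K ?F)"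
  proof (intro equalityI subsetI)
    fix Z assume "Z \<in> kernel (K0_num K T) (K0_num K ?Q) \<psi>"
    then obtain x where x: "?keys x \<subseteq> Ob T" "Z = T.num_cls x" "Q.num_cls x = \<one>\<^bsub>K0_num K ?Q\<^esub>"
      by (auto simp: kernel_def T.num_cls_surj \<psi>_cls)
    with ker2[of x] obtain y where "?keys y \<subseteq> Ob ?F" "Z = T.num_cls y" by auto
    then show "Z \<in> \<phi> ` carrier (K0_num K ?F)"
      using \<phi>_cls[of y] by (auto simp: S.num_cls_surj image_iff)
  next
    fix Z assume "Z \<in> \<phi> ` carrier (K0_num K ?F)"
    then obtain x where x: "?keys x \<subseteq> Ob ?F" "Z = T.num_cls x"
      by (auto simp: S.num_cls_surj \<phi>_cls)
    then have "?keys x \<subseteq> Ob T" using ObS by auto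
    with x show "Z \<in> kernel (K0_num K T) (K0_num K ?Q) \<psi>"
      by (auto simp: kernel_def T.num_cls_surj \<psi>_cls ker1)
  qed
  have \<phi>_class: "\<phi> (K0_num_class K ?F a) = K0_num_class K T a" if "a \<in> Ob ?F" for a
    using \<phi>_cls[of "frag_of a"] that by (simp add: S.num_cls_of T.num_cls_of)
  have \<psi>_class: "\<psi> (K0_num_class K T a) = K0_num_class K ?Q a" if "a \<in> Ob T" for a
    using \<psi>_cls[of "frag_of a"] that by (simp add: T.num_cls_of Q.num_cls_of)
  have "induces_on_K0_num K ?F T inclusion_functor \<phi>" "induces_on_K0_num K T ?Q (quotient_functor T S) \<psi>"
    using \<phi> \<phi>_class \<psi> \<psi>_class by (simp_all add: induces_on_K0_num_def inclusion_functor_def quotient_functor_def)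
  moreover have "group_hom (K0_num K ?F) (K0_num K T) \<phi>"
    using \<phi> S.group_K0_num T.group_K0_num by (simp add: group_hom_def group_hom_axioms_def)
  moreover have "group (singleton_group \<one>\<^bsub>K0_num K ?Q\<^esub>)"
    by simp
  moreover have "(\<lambda>x. \<one>\<^bsub>K0_num K ?Q\<^esub>) \<in> hom (K0_num K ?Q) (singleton_group \<one>\<^bsub>K0_num K ?Q\<^esub>)"
    by (simp add: hom_def singleton_group_def)
  moreover have "kernel (K0_num K ?Q) (singleton_group \<one>\<^bsub>K0_num K ?Q\<^esub>) (\<lambda>x. \<one>\<^bsub>K0_num K ?Q\<^esub>) =
      \<psi> ` carrier (K0_num K T)"
    using surj by (simp add: kernel_def singleton_group_def)
  ultimately show ?thesis
    using \<psi> ker Q.group_K0_num by (intro exI[of _ \<phi>] exI[of _ \<psi>]) simp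
qed

end
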